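(* Let $(\mathcal{C},\mathcal{N})$ be a homological category and consider a commutative diagram in $\mathcal{C}$ with rows $A\xrightarrow{f}B\xrightarrow{g}C$ and $A'\xrightarrow{f'}B'\xrightarrow{g'}C'$ and vertical morphisms $a:A\to A'$, $b:B\to B'$, $c:C\to C'$ (so $bf=f'a$, $cg=g'b$), where $gf$ and $g'f'$ are null and $b$ is an exact morphism. Let $S$ be the left-hand and $T$ the right-hand square, and let $h:H\to H'$ be the induced morphism from the homology $H$ of the upper row to the homology $H'$ of the lower row. Then the morphisms $\alpha,\beta,\beta',\alpha'$ described in the context are well defined, and, together with the Lambek morphism $\Lambda:\operatorname{Im}S\to\operatorname{Ker}T$, they form a null sequence $$H\bigl(\operatorname{Ker}(bf)\to\operatorname{Ker}b\to\operatorname{Ker}c\bigr)\xrightarrow{\alpha}\operatorname{Ker}h\xrightarrow{\beta}\operatorname{Im}S\xrightarrow{\Lambda}\operatorname{Ker}T\xrightarrow{\beta'}\operatorname{Coker}h\xrightarrow{\alpha'}H\bigl(\operatorname{Coker}a\to\operatorname{Coker}b\to\operatorname{Coker}(g'b)\bigr),$$ i.e. all compositions of two consecutive morphisms are null.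
   Context: **Homological categories.** An ideal in a category $\mathcal{C}$ is a class $\mathcal{N}$ of morphisms such that every legitimate composite $hfg$ with $f\in\mathcal{N}$ lies in $\mathcal{N}$; morphisms in $\mathcal{N}$ are called null, and an object $A$ is null if $\mathrm{id}_A\in\mathcal{N}$. The ideal is closed if every null morphism factors through a null object. A kernel of $f:A\to B$ is a morphism $\ker f:\operatorname{Ker}f\to A$ with $f\ker f\in\mathcal{N}$ such that every $x$ with $fx\in\mathcal{N}$ factors uniquely as $x=(\ker f)x'$; the cokernel $\operatorname{coker}f:B\to\operatorname{Coker}f$ is defined dually. $(\mathcal{C},\mathcal{N})$ is semiexact if $\mathcal{N}$ is a closed ideal and every morphism has a kernel and a cokernel. It is homological (in the sense of Grandis) if moreover kernels and cokernels are each closed under composition, and for every kernel $i:A\to B$ and cokernel $q:B\to C$ with $(\operatorname{coker}i)(\ker q)\in\mathcal{N}$ there exist a cokernel $\pi:A\to H$ and a kernel $\iota:H\to C$ with $qi=\iota\pi$. Put $\operatorname{im}f=\ker(\operatorname{coker}f):\operatorname{Im}f\to B$ and $\operatorname{coim}f=\operatorname{coker}(\ker f):A\to\operatorname{Coim}f$. Every $f$ factors uniquely as $f=(\operatorname{im}f)\,\overline f\,\operatorname{coim}f$; $f$ is exact if $\overline f$ is an isomorphism (then $\operatorname{Coim}f$ is identified with $\operatorname{Im}f$). **Homology.** For a null sequence $X\xrightarrow{f}Y\xrightarrow{g}Z$ ($gf$ null), its homology $H(f,g)$, also written $H(X\to Y\to Z)$, is $\operatorname{Coker}(X\to\operatorname{Ker}g)$,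 canonically isomorphic (in a homological category) to $\operatorname{Ker}(\operatorname{Coker}f\to Z)$, where $X\to\operatorname{Ker}g$ and $\operatorname{Coker}f\to Z$ are induced by $f$ and $g$; the canonical isomorphism $m$ is the one with $\ker(\operatorname{Coker}f\to Z)\,m\,\operatorname{coker}(X\to\operatorname{Ker}g)=(\operatorname{coker}f)\ker g$. **Lambek invariants.** For a commutative square $S$ with top $f:A\to B$, left $a:A\to C$, right $b:B\to D$, bottom $g:C\to D$: let $M$ be the pullback of $\operatorname{im}b$ and $\operatorname{im}g$, with projection $l_S:M\to\operatorname{Im}b$, and $\lambda_S:A\to M$ the morphism induced by $\overline b(\operatorname{coim}b)f:A\to\operatorname{Im}b$ and $\overline g(\operatorname{coim}g)a:A\to\operatorname{Im}g$; put $\operatorname{Im}S=\operatorname{Coker}\lambda_S$. Let $N$ be the pushout of $\operatorname{coim}a$ and $\operatorname{coim}f$, with coprojection $r_S:\operatorname{Coim}a\to N$, and $\rho_S:N\to D$ the morphism induced by $g(\operatorname{im}a)\overline a:\operatorname{Coim}a\to D$ and $b(\operatorname{im}f)\overline f:\operatorname{Coim}f\to D$; put $\operatorname{Ker}S=\operatorname{Ker}\rho_S$. These objects do not change if the square is transposed. If $S,T$ are consecutive squares (as in the claim) with null rows and with exact common vertical morphism $b$, the Lambek morphism $\Lambda_{S,T}:\operatorname{Im}S\to\operatorname{Ker}T$ is the unique morphism with $r_T\,l_S=(\ker\rho_T)\,\Lambda_{S,T}\operatorname{coker}\lambda_S$ (with $\operatorname{Coim}b=\operatorname{Im}b$ via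 $\overline b$). It is known to be an isomorphism if in addition both rows are exact at the middle (a sequence $X\xrightarrow{f}Y\xrightarrow{g}Z$ is exact at $Y$ if $\operatorname{im}f=\ker g$). The same applies to two squares stacked vertically, with columns in place of rows and the common horizontal morphism exact. Put $\Lambda=\Lambda_{S,T}$. **The diagram.** Let $g^\flat:\operatorname{Coker}f\to C$ satisfy $g^\flat\operatorname{coker}f=g$, and let $f^\sharp:A\to\operatorname{Ker}g$, $f'^\sharp:A'\to\operatorname{Ker}g'$ satisfy $(\ker g)f^\sharp=f$, $(\ker g')f'^\sharp=f'$. Let $\widehat b:\operatorname{Ker}g\to\operatorname{Ker}g'$ and $\check b:\operatorname{Coker}f\to\operatorname{Coker}f'$ be induced by $b$. The morphism $h:H=\operatorname{Coker}f^\sharp\to H'=\operatorname{Coker}f'^\sharp$ is induced by $\widehat b$ (equivalently, it is induced by $\check b$ on right homologies). Let $\xi:\operatorname{Ker}b\to\operatorname{Ker}\check b$ and $\eta:\operatorname{Ker}\check b\to\operatorname{Ker}c$ be given by $(\ker\check b)\xi=(\operatorname{coker}f)\ker b$ and $(\ker c)\eta=g^\flat\ker\check b$. Then $\operatorname{Ker}h=\operatorname{Ker}\eta$ canonically (as subobjects of $\operatorname{Coker}f$, via $H=\operatorname{Ker}g^\flat$). Dually, $\eta':\operatorname{Coker}a\to\operatorname{Coker}\widehat b$ and $\xi':\operatorname{Coker}\widehat b\to\operatorname{Coker}b$ are given by $\eta'\operatorname{coker}a=(\operatorname{coker}\widehat b)f'^\sharp$ and $\xi'\operatorname{coker}\widehat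 b=(\operatorname{coker}b)\ker g'$, and $\operatorname{Coker}h=\operatorname{Coker}\eta'$ canonically. **$\alpha$.** Let $k:\operatorname{Ker}(bf)\to\operatorname{Ker}b$ satisfy $(\ker b)k=f\ker(bf)$. The first homology object is that of $\operatorname{Ker}(bf)\xrightarrow{k}\operatorname{Ker}b\xrightarrow{\eta\xi}\operatorname{Ker}c$, realized as $\operatorname{Coker}k'$ with $k':\operatorname{Ker}(bf)\to\operatorname{Ker}(\eta\xi)$, $\ker(\eta\xi)k'=k$. Let $v:\operatorname{Ker}(\eta\xi)\to\operatorname{Ker}\eta$ satisfy $(\ker\eta)v=\xi\ker(\eta\xi)$. Then $\alpha$ is the unique morphism with $\alpha\operatorname{coker}k'=v$. **$\beta$.** Let $S_1$ be the square with top $\operatorname{coker}f$, left $b$, right $\check b$, bottom $\operatorname{coker}f'$, and $S_2$ the square with top $\xi$, left $\ker b$, right $\ker\check b$, bottom $\operatorname{coker}f$; one has $\operatorname{Im}S_2=\operatorname{Coker}\xi$. By Lambek's theorem, $\Lambda_{S,S_1}:\operatorname{Im}S\to\operatorname{Ker}S_1$ and (vertically) $\Lambda_{S_2,S_1}:\operatorname{Im}S_2\to\operatorname{Ker}S_1$ are isomorphisms. Then $\beta=\Lambda_{S,S_1}^{-1}\Lambda_{S_2,S_1}(\operatorname{coker}\xi)\ker\eta$. **$\beta'$.** Let $T_1$ be the square with top $\ker g$, left $\widehat b$, right $b$, bottom $\ker g'$, and $T_2$ the square with top $\ker g'$, left $\operatorname{coker}\widehat b$, right $\operatorname{coker}b$,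 bottom $\xi'$; one has $\operatorname{Ker}T_2=\operatorname{Ker}\xi'$. The morphisms $\Lambda_{T_1,T}:\operatorname{Im}T_1\to\operatorname{Ker}T$ and (vertically) $\Lambda_{T_1,T_2}:\operatorname{Im}T_1\to\operatorname{Ker}T_2$ are isomorphisms, and $\beta'=(\operatorname{coker}\eta')(\ker\xi')\Lambda_{T_1,T_2}\Lambda_{T_1,T}^{-1}$. **$\alpha'$.** Let $l:\operatorname{Coker}b\to\operatorname{Coker}(g'b)$ satisfy $l\operatorname{coker}b=\operatorname{coker}(g'b)\,g'$. The last homology object is that of $\operatorname{Coker}a\xrightarrow{\xi'\eta'}\operatorname{Coker}b\xrightarrow{l}\operatorname{Coker}(g'b)$, realized as $\operatorname{Ker}l'$ with $l':\operatorname{Coker}(\xi'\eta')\to\operatorname{Coker}(g'b)$, $l'\operatorname{coker}(\xi'\eta')=l$. Let $u:\operatorname{Coker}\eta'\to\operatorname{Coker}(\xi'\eta')$ satisfy $u\operatorname{coker}\eta'=\operatorname{coker}(\xi'\eta')\,\xi'$. Then $\alpha'$ is the unique morphism with $(\ker l')\alpha'=u$. *)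

theory Defs
  imports Main
begin

section \<open>Categories with an ideal of null morphisms\<close>

record ('o, 'm) category =
  Obj :: "'o set"
  Arr :: "'m set"
  Dom :: "'m \<Rightarrow> 'o"
  Cod :: "'m \<Rightarrow> 'o"
  Ident :: "'o \<Rightarrow> 'm"
  Comp :: "'m \<Rightarrow> 'm \<Rightarrow> 'm"  (infixr "\<cdot>\<index>" 70)

text \<open>\<open>g \<cdot> f\<close> is the composite ``first \<open>f\<close>, then \<open>g\<close>''; it is meaningful only if \<open>Cod f = Dom g\<close>.\<close>

definition hom :: "('o, 'm, 'z) category_scheme \<Rightarrow> 'o \<Rightarrow> 'o \<Rightarrow> 'm set" where
  "hom C X Y = {f \<in> Arr C. Dom C f = X \<and> Cod C f = Y}"

record ('o, 'm) null_category = "('o, 'm) category" +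
  Null :: "'m set"

locale category =
  fixes C :: "('o, 'm, 'z) category_scheme" (structure)
  assumes Dom_in: "f \<in> Arr C \<Longrightarrow> Dom C f \<in> Obj C"
    and Cod_in: "f \<in> Arr C \<Longrightarrow> Cod C f \<in> Obj C"
    and Ident_in: "X \<in> Obj C \<Longrightarrow> Ident C X \<in> hom C X X"
    and Comp_in: "f \<in> hom C X Y \<Longrightarrow> g \<in> hom C Y Z \<Longrightarrow> g \<cdot> f \<in> hom C X Z"
    and Comp_assoc: "f \<in> hom C W X \<Longrightarrow> g \<in> hom C X Y \<Longrightarrow> h \<in> hom C Y Z \<Longrightarrow>
           (h \<cdot> g) \<cdot> f = h \<cdot> (g \<cdot> f)"
    and Comp_Ident: "f \<in> hom C X Y \<Longrightarrow> f \<cdot> Ident C X = f"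
    and Ident_Comp: "f \<in> hom C X Y \<Longrightarrow> Ident C Y \<cdot> f = f"

definition null_object :: "('o, 'm, 'z) null_category_scheme \<Rightarrow> 'o \<Rightarrow> bool" where
  "null_object C X \<longleftrightarrow> X \<in> Obj C \<and> Ident C X \<in> Null C"

locale closed_ideal_category = category C
  for C :: "('o, 'm, 'z) null_category_scheme" (structure) +
  assumes Null_sub: "Null C \<subseteq> Arr C"
    and Null_ideal: "g \<in> hom C W X \<Longrightarrow> f \<in> hom C X Y \<Longrightarrow> f \<in> Null C \<Longrightarrow> h \<in> hom C Y Z \<Longrightarrow>
           h \<cdot> f \<cdot> g \<in> Null C"
    and Null_closed: "f \<in> hom C X Y \<Longrightarrow> f \<in> Null C \<Longrightarrow>
           \<exists>E p q. null_object C E \<and> p \<in> hom C X E \<and> q \<in> hom C E Y \<and> f = q \<cdot> p"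


section \<open>Liftings, isomorphisms, kernels and cokernels\<close>

definition is_lift :: "('o, 'm, 'z) category_scheme \<Rightarrow> 'm \<Rightarrow> 'm \<Rightarrow> 'm \<Rightarrow> bool" where
  "is_lift C k x y \<longleftrightarrow> y \<in> hom C (Dom C x) (Dom C k) \<and> k \<cdot>\<^bsub>C\<^esub> y = x"

definition is_colift :: "('o, 'm, 'z) category_scheme \<Rightarrow> 'm \<Rightarrow> 'm \<Rightarrow> 'm \<Rightarrow> bool" where
  "is_colift C q x y \<longleftrightarrow> y \<in> hom C (Cod C q) (Cod C x) \<and> y \<cdot>\<^bsub>C\<^esub> q = x"

text \<open>The definite descriptions below denote the intended morphisms only where existence and
  uniqueness hold.\<close>

definition lift :: "('o, 'm, 'z) category_scheme \<Rightarrow> 'm \<Rightarrow> 'm \<Rightarrow> 'm" where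
  "lift C k x = (THE y. is_lift C k x y)"

definition colift :: "('o, 'm, 'z) category_scheme \<Rightarrow> 'm \<Rightarrow> 'm \<Rightarrow> 'm" where
  "colift C q x = (THE y. is_colift C q x y)"

definition lifts_uniquely :: "('o, 'm, 'z) category_scheme \<Rightarrow> 'm \<Rightarrow> 'm \<Rightarrow> bool" where
  "lifts_uniquely C k x \<longleftrightarrow> (\<exists>!y. is_lift C k x y)"

definition colifts_uniquely :: "('o, 'm, 'z) category_scheme \<Rightarrow> 'm \<Rightarrow> 'm \<Rightarrow> bool" where
  "colifts_uniquely C q x \<longleftrightarrow> (\<exists>!y. is_colift C q x y)"

definition is_inverse :: "('o, 'm, 'z) category_scheme \<Rightarrow> 'm \<Rightarrow> 'm \<Rightarrow> bool" where
  "is_inverse C f g \<longleftrightarrow> f \<in> Arr C \<and> g \<in> hom C (Cod C f) (Dom C f) \<and>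
     g \<cdot>\<^bsub>C\<^esub> f = Ident C (Dom C f) \<and> f \<cdot>\<^bsub>C\<^esub> g = Ident C (Cod C f)"

definition is_iso :: "('o, 'm, 'z) category_scheme \<Rightarrow> 'm \<Rightarrow> bool" where
  "is_iso C f \<longleftrightarrow> (\<exists>g. is_inverse C f g)"

definition inverse_arr :: "('o, 'm, 'z) category_scheme \<Rightarrow> 'm \<Rightarrow> 'm" where
  "inverse_arr C f = (THE g. is_inverse C f g)"

definition is_kernel :: "('o, 'm, 'z) null_category_scheme \<Rightarrow> 'm \<Rightarrow> 'm \<Rightarrow> bool" where
  "is_kernel C f k \<longleftrightarrow> f \<in> Arr C \<and> k \<in> Arr C \<and> Cod C k = Dom C f \<and> f \<cdot>\<^bsub>C\<^esub> k \<in> Null C \<and>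
     (\<forall>x \<in> Arr C. Cod C x = Dom C f \<longrightarrow> f \<cdot>\<^bsub>C\<^esub> x \<in> Null C \<longrightarrow> lifts_uniquely C k x)"

definition is_cokernel :: "('o, 'm, 'z) null_category_scheme \<Rightarrow> 'm \<Rightarrow> 'm \<Rightarrow> bool" where
  "is_cokernel C f q \<longleftrightarrow> f \<in> Arr C \<and> q \<in> Arr C \<and> Dom C q = Cod C f \<and> q \<cdot>\<^bsub>C\<^esub> f \<in> Null C \<and>
     (\<forall>x \<in> Arr C. Dom C x = Cod C f \<longrightarrow> x \<cdot>\<^bsub>C\<^esub> f \<in> Null C \<longrightarrow> colifts_uniquely C q x)"

locale semiexact_category = closed_ideal_category C
  for C :: "('o, 'm, 'z) null_category_scheme" (structure) +
  assumes ex_kernel: "f \<in> Arr C \<Longrightarrow> \<exists>k. is_kernel C f k"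
    and ex_cokernel: "f \<in> Arr C \<Longrightarrow> \<exists>q. is_cokernel C f q"

locale homological_category = semiexact_category C
  for C :: "('o, 'm, 'z) null_category_scheme" (structure) +
  assumes kernel_comp: "is_kernel C f i \<Longrightarrow> is_kernel C g j \<Longrightarrow> Cod C i = Dom C j \<Longrightarrow>
           \<exists>x. is_kernel C x (j \<cdot> i)"
    and cokernel_comp: "is_cokernel C f p \<Longrightarrow> is_cokernel C g q \<Longrightarrow> Cod C p = Dom C q \<Longrightarrow>
           \<exists>x. is_cokernel C x (q \<cdot> p)"
    and subquotient: "is_kernel C f i \<Longrightarrow> is_cokernel C g q \<Longrightarrow> Cod C i = Dom C q \<Longrightarrow>
           is_cokernel C i ci \<Longrightarrow> is_kernel C q kq \<Longrightarrow> ci \<cdot> kq \<in> Null C \<Longrightarrow>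
           \<exists>H p j x y. p \<in> hom C (Dom C i) H \<and> is_cokernel C x p \<and>
                       j \<in> hom C H (Cod C q) \<and> is_kernel C y j \<and> q \<cdot> i = j \<cdot> p"


section \<open>Chosen kernels, cokernels, pullbacks and pushouts\<close>

definition is_pullback :: "('o, 'm, 'z) category_scheme \<Rightarrow> 'm \<Rightarrow> 'm \<Rightarrow> 'm \<Rightarrow> 'm \<Rightarrow> bool" where
  "is_pullback C f g p q \<longleftrightarrow>
     f \<in> Arr C \<and> g \<in> Arr C \<and> Cod C f = Cod C g \<and>
     p \<in> hom C (Dom C p) (Dom C f) \<and> q \<in> hom C (Dom C p) (Dom C g) \<and> f \<cdot>\<^bsub>C\<^esub> p = g \<cdot>\<^bsub>C\<^esub> q \<and>
     (\<forall>X. \<forall>x \<in> hom C X (Dom C f). \<forall>y \<in> hom C X (Dom C g). f \<cdot>\<^bsub>C\<^esub> x = g \<cdot>\<^bsub>C\<^esub> y \<longrightarrow>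
        (\<exists>!z. z \<in> hom C X (Dom C p) \<and> p \<cdot>\<^bsub>C\<^esub> z = x \<and> q \<cdot>\<^bsub>C\<^esub> z = y))"

definition is_pushout :: "('o, 'm, 'z) category_scheme \<Rightarrow> 'm \<Rightarrow> 'm \<Rightarrow> 'm \<Rightarrow> 'm \<Rightarrow> bool" where
  "is_pushout C f g p q \<longleftrightarrow>
     f \<in> Arr C \<and> g \<in> Arr C \<and> Dom C f = Dom C g \<and>
     p \<in> hom C (Cod C f) (Cod C p) \<and> q \<in> hom C (Cod C g) (Cod C p) \<and> p \<cdot>\<^bsub>C\<^esub> f = q \<cdot>\<^bsub>C\<^esub> g \<and>
     (\<forall>X. \<forall>x \<in> hom C (Cod C f) X. \<forall>y \<in> hom C (Cod C g) X. x \<cdot>\<^bsub>C\<^esub> f = y \<cdot>\<^bsub>C\<^esub> g \<longrightarrow>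
        (\<exists>!z. z \<in> hom C (Cod C p) X \<and> z \<cdot>\<^bsub>C\<^esub> p = x \<and> z \<cdot>\<^bsub>C\<^esub> q = y))"

text \<open>Kernels, cokernels, pullbacks and pushouts are determined only up to isomorphism. Here they
  are given by arbitrary choice functions. Pullbacks and pushouts need not exist in
  general, so \<open>Pb\<close> and \<open>Po\<close> (returning the pair of projections, resp. coprojections) are
  constrained only where a pullback, resp. pushout, exists.\<close>

record ('o, 'm) chosen_category = "('o, 'm) null_category" +
  Ker :: "'m \<Rightarrow> 'm"  ("ker\<index> _" [81] 80)
  Coker :: "'m \<Rightarrow> 'm"  ("coker\<index> _" [81] 80)
  Pb :: "'m \<Rightarrow> 'm \<Rightarrow> 'm \<times> 'm"
  Po :: "'m \<Rightarrow> 'm \<Rightarrow> 'm \<times> 'm"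

locale chosen_limits =
  fixes C :: "('o, 'm, 'z) chosen_category_scheme" (structure)
  assumes Ker_kernel: "f \<in> Arr C \<Longrightarrow> is_kernel C f (ker f)"
    and Coker_cokernel: "f \<in> Arr C \<Longrightarrow> is_cokernel C f (coker f)"
    and Pb_pullback: "is_pullback C f g p q \<Longrightarrow> is_pullback C f g (fst (Pb C f g)) (snd (Pb C f g))"
    and Po_pushout: "is_pushout C f g p q \<Longrightarrow> is_pushout C f g (fst (Po C f g)) (snd (Po C f g))"

definition im :: "('o, 'm, 'z) chosen_category_scheme \<Rightarrow> 'm \<Rightarrow> 'm" where
  "im C f = ker\<^bsub>C\<^esub> (coker\<^bsub>C\<^esub> f)"

definition coim :: "('o, 'm, 'z) chosen_category_scheme \<Rightarrow> 'm \<Rightarrow> 'm" where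
  "coim C f = coker\<^bsub>C\<^esub> (ker\<^bsub>C\<^esub> f)"

definition is_bar :: "('o, 'm, 'z) chosen_category_scheme \<Rightarrow> 'm \<Rightarrow> 'm \<Rightarrow> bool" where
  "is_bar C f y \<longleftrightarrow> y \<in> hom C (Cod C (coim C f)) (Dom C (im C f)) \<and>
     f = im C f \<cdot>\<^bsub>C\<^esub> y \<cdot>\<^bsub>C\<^esub> coim C f"

definition bar :: "('o, 'm, 'z) chosen_category_scheme \<Rightarrow> 'm \<Rightarrow> 'm" where
  "bar C f = (THE y. is_bar C f y)"

definition exact_arr :: "('o, 'm, 'z) chosen_category_scheme \<Rightarrow> 'm \<Rightarrow> bool" where
  "exact_arr C f \<longleftrightarrow> f \<in> Arr C \<and> is_iso C (bar C f)"


section \<open>Lambek invariants of squares\<close>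

datatype 'm square = Square (s_top: 'm) (s_left: 'm) (s_right: 'm) (s_bottom: 'm)

text \<open>For a square with top \<open>f\<close>, left \<open>a\<close>, right \<open>b\<close> and bottom \<open>g\<close>: \<open>sq_pr1\<close> is the projection
  to \<open>Im b\<close>, \<open>sq_pr2\<close> the projection to \<open>Im g\<close>, \<open>sq_in1\<close> the coprojection from \<open>Coim a\<close> and
  \<open>sq_in2\<close> the coprojection from \<open>Coim f\<close>. Transposing the square swaps 1 and 2, so for squares
  stacked vertically \<open>sq_pr2\<close> and \<open>sq_in2\<close> take the places of the morphisms l and r, while \<open>Im S\<close>
  and \<open>Ker S\<close> are unchanged.\<close>

definition sq_pr1 :: "('o, 'm, 'z) chosen_category_scheme \<Rightarrow> 'm square \<Rightarrow> 'm" where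
  "sq_pr1 C S = fst (Pb C (im C (s_right S)) (im C (s_bottom S)))"

definition sq_pr2 :: "('o, 'm, 'z) chosen_category_scheme \<Rightarrow> 'm square \<Rightarrow> 'm" where
  "sq_pr2 C S = snd (Pb C (im C (s_right S)) (im C (s_bottom S)))"

definition sq_in1 :: "('o, 'm, 'z) chosen_category_scheme \<Rightarrow> 'm square \<Rightarrow> 'm" where
  "sq_in1 C S = fst (Po C (coim C (s_left S)) (coim C (s_top S)))"

definition sq_in2 :: "('o, 'm, 'z) chosen_category_scheme \<Rightarrow> 'm square \<Rightarrow> 'm" where
  "sq_in2 C S = snd (Po C (coim C (s_left S)) (coim C (s_top S)))"

definition is_sq_lam :: "('o, 'm, 'z) chosen_category_scheme \<Rightarrow> 'm square \<Rightarrow> 'm \<Rightarrow> bool" where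
  "is_sq_lam C S x \<longleftrightarrow> x \<in> hom C (Dom C (s_top S)) (Dom C (sq_pr1 C S)) \<and>
     sq_pr1 C S \<cdot>\<^bsub>C\<^esub> x = bar C (s_right S) \<cdot>\<^bsub>C\<^esub> coim C (s_right S) \<cdot>\<^bsub>C\<^esub> s_top S \<and>
     sq_pr2 C S \<cdot>\<^bsub>C\<^esub> x = bar C (s_bottom S) \<cdot>\<^bsub>C\<^esub> coim C (s_bottom S) \<cdot>\<^bsub>C\<^esub> s_left S"

definition sq_lam :: "('o, 'm, 'z) chosen_category_scheme \<Rightarrow> 'm square \<Rightarrow> 'm" where
  "sq_lam C S = (THE x. is_sq_lam C S x)"

definition is_sq_rho :: "('o, 'm, 'z) chosen_category_scheme \<Rightarrow> 'm square \<Rightarrow> 'm \<Rightarrow> bool" where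
  "is_sq_rho C S x \<longleftrightarrow> x \<in> hom C (Cod C (sq_in1 C S)) (Cod C (s_bottom S)) \<and>
     x \<cdot>\<^bsub>C\<^esub> sq_in1 C S = s_bottom S \<cdot>\<^bsub>C\<^esub> im C (s_left S) \<cdot>\<^bsub>C\<^esub> bar C (s_left S) \<and>
     x \<cdot>\<^bsub>C\<^esub> sq_in2 C S = s_right S \<cdot>\<^bsub>C\<^esub> im C (s_top S) \<cdot>\<^bsub>C\<^esub> bar C (s_top S)"

definition sq_rho :: "('o, 'm, 'z) chosen_category_scheme \<Rightarrow> 'm square \<Rightarrow> 'm" where
  "sq_rho C S = (THE x. is_sq_rho C S x)"

definition sq_Im :: "('o, 'm, 'z) chosen_category_scheme \<Rightarrow> 'm square \<Rightarrow> 'o" where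
  "sq_Im C S = Cod C (coker\<^bsub>C\<^esub> (sq_lam C S))"

definition sq_Ker :: "('o, 'm, 'z) chosen_category_scheme \<Rightarrow> 'm square \<Rightarrow> 'o" where
  "sq_Ker C S = Dom C (ker\<^bsub>C\<^esub> (sq_rho C S))"

definition sq_Im_defined :: "('o, 'm, 'z) chosen_category_scheme \<Rightarrow> 'm square \<Rightarrow> bool" where
  "sq_Im_defined C S \<longleftrightarrow>
     is_pullback C (im C (s_right S)) (im C (s_bottom S)) (sq_pr1 C S) (sq_pr2 C S) \<and>
     (\<exists>!x. is_sq_lam C S x)"

definition sq_Ker_defined :: "('o, 'm, 'z) chosen_category_scheme \<Rightarrow> 'm square \<Rightarrow> bool" where
  "sq_Ker_defined C S \<longleftrightarrow>
     is_pushout C (coim C (s_left S)) (coim C (s_top S)) (sq_in1 C S) (sq_in2 C S) \<and>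
     (\<exists>!x. is_sq_rho C S x)"

text \<open>Lambek morphism of two horizontally consecutive squares, \<open>s_right S = s_left T\<close>.\<close>

definition is_lambek_h ::
    "('o, 'm, 'z) chosen_category_scheme \<Rightarrow> 'm square \<Rightarrow> 'm square \<Rightarrow> 'm \<Rightarrow> bool" where
  "is_lambek_h C S T L \<longleftrightarrow> L \<in> hom C (sq_Im C S) (sq_Ker C T) \<and>
     sq_in1 C T \<cdot>\<^bsub>C\<^esub> inverse_arr C (bar C (s_right S)) \<cdot>\<^bsub>C\<^esub> sq_pr1 C S =
     ker\<^bsub>C\<^esub> (sq_rho C T) \<cdot>\<^bsub>C\<^esub> L \<cdot>\<^bsub>C\<^esub> coker\<^bsub>C\<^esub> (sq_lam C S)"

definition lambek_h :: "('o, 'm, 'z) chosen_category_scheme \<Rightarrow> 'm square \<Rightarrow> 'm square \<Rightarrow> 'm" where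
  "lambek_h C S T = (THE L. is_lambek_h C S T L)"

text \<open>Lambek morphism of two vertically stacked squares, \<open>s_bottom S = s_top T\<close>.\<close>

definition is_lambek_v ::
    "('o, 'm, 'z) chosen_category_scheme \<Rightarrow> 'm square \<Rightarrow> 'm square \<Rightarrow> 'm \<Rightarrow> bool" where
  "is_lambek_v C S T L \<longleftrightarrow> L \<in> hom C (sq_Im C S) (sq_Ker C T) \<and>
     sq_in2 C T \<cdot>\<^bsub>C\<^esub> inverse_arr C (bar C (s_bottom S)) \<cdot>\<^bsub>C\<^esub> sq_pr2 C S =
     ker\<^bsub>C\<^esub> (sq_rho C T) \<cdot>\<^bsub>C\<^esub> L \<cdot>\<^bsub>C\<^esub> coker\<^bsub>C\<^esub> (sq_lam C S)"

definition lambek_v :: "('o, 'm, 'z) chosen_category_scheme \<Rightarrow> 'm square \<Rightarrow> 'm square \<Rightarrow> 'm" where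
  "lambek_v C S T = (THE L. is_lambek_v C S T L)"


section \<open>Homology\<close>

definition is_homology_iso ::
    "('o, 'm, 'z) chosen_category_scheme \<Rightarrow> 'm \<Rightarrow> 'm \<Rightarrow> 'm \<Rightarrow> bool" where
  "is_homology_iso C f g m \<longleftrightarrow>
     m \<in> hom C (Cod C (coker\<^bsub>C\<^esub> (lift C (ker\<^bsub>C\<^esub> g) f))) (Dom C (ker\<^bsub>C\<^esub> (colift C (coker\<^bsub>C\<^esub> f) g))) \<and>
     ker\<^bsub>C\<^esub> (colift C (coker\<^bsub>C\<^esub> f) g) \<cdot>\<^bsub>C\<^esub> m \<cdot>\<^bsub>C\<^esub> coker\<^bsub>C\<^esub> (lift C (ker\<^bsub>C\<^esub> g) f) =
     coker\<^bsub>C\<^esub> f \<cdot>\<^bsub>C\<^esub> ker\<^bsub>C\<^esub> g"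

text \<open>The canonical isomorphism from the left to the right realization of \<open>H(f, g)\<close>.\<close>

definition homology_iso :: "('o, 'm, 'z) chosen_category_scheme \<Rightarrow> 'm \<Rightarrow> 'm \<Rightarrow> 'm" where
  "homology_iso C f g = (THE m. is_homology_iso C f g m)"

end

(*
  The Lambek isomorphisms and the comparison of the two realizations of homology are instances of one
  fact: if l is a kernel of g, r a cokernel of f, f = l phi and g = gamma r, then the epi-mono
  factorization of r l supplied by the subquotient axiom is coker phi followed by ker gamma, up to a
  unique isomorphism. For a common exact morphism b one applies this to the null pair
  A -> Im b -> D' given by the outer corners.

  The composite of Lambda with beta is null because the pushouts defining Ker S1 and Ker T are linked
  by a morphism theta compatible with the coprojections; thus Lambda beta becomes the restriction to
  Ker eta of a morphism w : Coker f -> N with w (coker f) = r_T (coim g), and w vanishes on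
  Ker(Coker f -> C), which is a quotient of Ker g. The second half of the sequence is obtained in the
  opposite category.
*)
theory Submission
  imports Defs
begin

section \<open>The opposite category\<close>

text \<open>Duality is literal: \<open>opp\<close> also exchanges the chosen kernels with the
  cokernels and the chosen pullbacks with the pushouts, so the dual of a named construction equals
  its counterpart instead of being isomorphic to it. Composites get bracketed the other way, so
  \<open>bar\<close> and the invariants of squares are translated only once the arrows are known to
  be typed. The axioms provide no pullbacks or pushouts. Those needed exist because one leg is a
  kernel or a cokernel: pulling \<open>ker g\<close> back along \<open>f\<close> gives the kernel of
  \<open>g \<cdot> f\<close>. Hence projections are kernels and coprojections are cokernels, as the
  fact on subquotients demands. That fact rests on kernels and cokernels reflecting nullity, which
  comes from the ideal being closed, and on their closure under composition. The rows through
  \<open>S\<close> and \<open>T\<close> are only null. Replacing \<open>T\<close> by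
  \<open>S1\<close> makes the rows exact in the middle, so \<open>beta\<close> may invert the Lambek
  morphism of \<open>S\<close> and \<open>S1\<close>, while Lambda itself need not be
  invertible.\<close>

definition opp :: "('o, 'm) chosen_category \<Rightarrow> ('o, 'm) chosen_category" where
  "opp C = \<lparr>Obj = Obj C, Arr = Arr C, Dom = Cod C, Cod = Dom C, Ident = Ident C,
     Comp = (\<lambda>g f. Comp C f g), Null = Null C, Ker = Coker C, Coker = Ker C,
     Pb = Po C, Po = Pb C\<rparr>"

definition monic :: "('o, 'm, 'z) category_scheme \<Rightarrow> 'm \<Rightarrow> bool" where
  "monic C k \<longleftrightarrow> k \<in> Arr C \<and> (\<forall>x \<in> Arr C. \<forall>y \<in> Arr C. Cod C x = Dom C k \<longrightarrow> Cod C y = Dom C k \<longrightarrow>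
     k \<cdot>\<^bsub>C\<^esub> x = k \<cdot>\<^bsub>C\<^esub> y \<longrightarrow> x = y)"

definition epic :: "('o, 'm, 'z) category_scheme \<Rightarrow> 'm \<Rightarrow> bool" where
  "epic C q \<longleftrightarrow> q \<in> Arr C \<and> (\<forall>x \<in> Arr C. \<forall>y \<in> Arr C. Dom C x = Cod C q \<longrightarrow> Dom C y = Cod C q \<longrightarrow>
     x \<cdot>\<^bsub>C\<^esub> q = y \<cdot>\<^bsub>C\<^esub> q \<longrightarrow> x = y)"

text \<open>The square read in the opposite category; it is also reflected so that consecutive squares
  remain consecutive, in reverse order.\<close>

fun flip :: "'m square \<Rightarrow> 'm square" where
  "flip (Square f a b g) = Square g b a f"

lemma flip_sel [simp]:
  "s_top (flip S) = s_bottom S" "s_bottom (flip S) = s_top S"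
  "s_left (flip S) = s_right S" "s_right (flip S) = s_left S"
  by (cases S; simp)+

lemma opp_sel [simp]:
  "Obj (opp C) = Obj C" "Arr (opp C) = Arr C" "Dom (opp C) = Cod C" "Cod (opp C) = Dom C"
  "Ident (opp C) = Ident C" "Comp (opp C) g f = Comp C f g" "Null (opp C) = Null C"
  "Ker (opp C) = Coker C" "Coker (opp C) = Ker C" "Pb (opp C) = Po C" "Po (opp C) = Pb C"
  by (simp_all add: opp_def)

lemma opp_hom [simp]: "hom (opp C) X Y = hom C Y X"
  by (auto simp: hom_def)

lemma opp_null_object [simp]: "null_object (opp C) = null_object C"
  by (auto simp: null_object_def)

lemma opp_is_lift [simp]: "is_lift (opp C) = is_colift C" "is_colift (opp C) = is_lift C"
  by (auto simp: is_lift_def is_colift_def fun_eq_iff)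

lemma opp_lift [simp]: "lift (opp C) = colift C" "colift (opp C) = lift C"
  "lifts_uniquely (opp C) = colifts_uniquely C" "colifts_uniquely (opp C) = lifts_uniquely C"
  by (auto simp: lift_def colift_def lifts_uniquely_def colifts_uniquely_def fun_eq_iff)

lemma opp_is_inverse [simp]: "is_inverse (opp C) = is_inverse C"
  by (auto simp: is_inverse_def fun_eq_iff)

lemma opp_iso [simp]: "is_iso (opp C) = is_iso C" "inverse_arr (opp C) = inverse_arr C"
  by (auto simp: is_iso_def inverse_arr_def fun_eq_iff)

lemma opp_kernel [simp]: "is_kernel (opp C) = is_cokernel C" "is_cokernel (opp C) = is_kernel C"
  by (auto simp: is_kernel_def is_cokernel_def fun_eq_iff)

lemma opp_pullback [simp]:
  "is_pullback (opp C) = is_pushout C" "is_pushout (opp C) = is_pullback C"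
  by (auto simp: is_pullback_def is_pushout_def fun_eq_iff)

lemma opp_im [simp]: "im (opp C) = coim C" "coim (opp C) = im C"
  by (auto simp: im_def coim_def fun_eq_iff)

lemma opp_sq_pr [simp]:
  "sq_pr1 (opp C) (flip S) = sq_in1 C S" "sq_pr2 (opp C) (flip S) = sq_in2 C S"
  "sq_in1 (opp C) (flip S) = sq_pr1 C S" "sq_in2 (opp C) (flip S) = sq_pr2 C S"
  by (auto simp: sq_pr1_def sq_pr2_def sq_in1_def sq_in2_def)

lemma opp_monic [simp]: "monic (opp C) = epic C" "epic (opp C) = monic C"
  by (auto simp: monic_def epic_def fun_eq_iff)

section \<open>Isomorphisms, cancellation and unique liftings\<close>

context category
begin

lemma comp_typing [simp]:
  assumes "f \<in> Arr C" "g \<in> Arr C" "Cod C f = Dom C g"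
  shows "g \<cdot> f \<in> Arr C" "Dom C (g \<cdot> f) = Dom C f" "Cod C (g \<cdot> f) = Cod C g"
  using Comp_in[of f "Dom C f" "Cod C f" g "Cod C g"] assms by (auto simp: hom_def)

lemma comp_assoc [simp]:
  assumes "f \<in> Arr C" "g \<in> Arr C" "h \<in> Arr C" "Cod C f = Dom C g" "Cod C g = Dom C h"
  shows "(h \<cdot> g) \<cdot> f = h \<cdot> (g \<cdot> f)"
  using Comp_assoc[of f "Dom C f" "Cod C f" g "Cod C g" h "Cod C h"] assms by (auto simp: hom_def)

text \<open>Simplification brackets composites to the right, so an equation
  \<open>g \<cdot> f = e\<close> no longer matches once a further arrow precedes \<open>f\<close>.
  This form rewrites there.\<close>

lemma comp_assoc_subst:
  assumes "g \<cdot> f = e" "f \<in> Arr C" "g \<in> Arr C" "x \<in> Arr C" "Cod C f = Dom C g" "Cod C x = Dom C f"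
  shows "g \<cdot> (f \<cdot> x) = e \<cdot> x"
  using comp_assoc[of x f g] assms by simp

lemma ident_typing [simp]:
  assumes "X \<in> Obj C"
  shows "Ident C X \<in> Arr C" "Dom C (Ident C X) = X" "Cod C (Ident C X) = X"
  using Ident_in[OF assms] by (auto simp: hom_def)

lemma comp_ident [simp]: "f \<in> Arr C \<Longrightarrow> Dom C f = X \<Longrightarrow> f \<cdot> Ident C X = f"
  using Comp_Ident[of f X "Cod C f"] by (auto simp: hom_def)

lemma ident_comp [simp]: "f \<in> Arr C \<Longrightarrow> Cod C f = X \<Longrightarrow> Ident C X \<cdot> f = f"
  using Ident_Comp[of f "Dom C f" X] by (auto simp: hom_def)

declare Dom_in [simp] Cod_in [simp]

lemma inverse_unique:
  assumes "is_inverse C f g" "is_inverse C f g'"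
  shows "g = g'"
  using assms comp_assoc[of g' f g] by (auto simp: is_inverse_def hom_def simp del: comp_assoc)

lemma is_inverse_inverse_arr: "is_iso C f \<Longrightarrow> is_inverse C f (inverse_arr C f)"
  unfolding is_iso_def inverse_arr_def using inverse_unique by (metis theI)

lemma iso_Arr: "is_iso C f \<Longrightarrow> f \<in> Arr C"
  by (auto simp: is_iso_def is_inverse_def)

lemma inverse_arr_props [simp]:
  assumes "is_iso C f"
  shows "inverse_arr C f \<in> Arr C" "Dom C (inverse_arr C f) = Cod C f"
    "Cod C (inverse_arr C f) = Dom C f"
    "inverse_arr C f \<cdot> f = Ident C (Dom C f)" "f \<cdot> inverse_arr C f = Ident C (Cod C f)"
  using is_inverse_inverse_arr[OF assms] by (auto simp: is_inverse_def hom_def)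

lemma inverse_arr_cancel [simp]:
  assumes "is_iso C f"
  shows "x \<in> Arr C \<Longrightarrow> Cod C x = Dom C f \<Longrightarrow> inverse_arr C f \<cdot> f \<cdot> x = x"
    "x \<in> Arr C \<Longrightarrow> Cod C x = Cod C f \<Longrightarrow> f \<cdot> inverse_arr C f \<cdot> x = x"
  using iso_Arr[OF assms] assms by (simp_all add: comp_assoc_subst[OF inverse_arr_props(4)]
    comp_assoc_subst[OF inverse_arr_props(5)])

lemma is_isoI:
  assumes "f \<in> Arr C" "g \<in> Arr C" "Dom C g = Cod C f" "Cod C g = Dom C f"
    "g \<cdot> f = Ident C (Dom C f)" "f \<cdot> g = Ident C (Cod C f)"
  shows "is_iso C f"
  using assms unfolding is_iso_def is_inverse_def by (auto simp: hom_def)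

lemma iso_inverse_arr: "is_iso C f \<Longrightarrow> is_iso C (inverse_arr C f)"
  by (rule is_isoI[where g = f]) (simp_all add: iso_Arr)

lemma iso_comp:
  assumes "is_iso C f" "is_iso C g" "Cod C f = Dom C g"
  shows "is_iso C (g \<cdot> f)"
  using assms iso_Arr[of f] iso_Arr[of g]
  by (intro is_isoI[where g = "inverse_arr C f \<cdot> inverse_arr C g"]) simp_all

lemma monicD: "monic C k \<Longrightarrow> k \<cdot> x = k \<cdot> y \<Longrightarrow> x \<in> Arr C \<Longrightarrow> y \<in> Arr C \<Longrightarrow>
    Cod C x = Dom C k \<Longrightarrow> Cod C y = Dom C k \<Longrightarrow> x = y"
  by (auto simp: monic_def)

lemma epicD: "epic C q \<Longrightarrow> x \<cdot> q = y \<cdot> q \<Longrightarrow> x \<in> Arr C \<Longrightarrow> y \<in> Arr C \<Longrightarrow>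
    Dom C x = Cod C q \<Longrightarrow> Dom C y = Cod C q \<Longrightarrow> x = y"
  by (auto simp: epic_def)

lemma monic_comp:
  assumes "monic C f" "monic C g" "Cod C f = Dom C g"
  shows "monic C (g \<cdot> f)"
proof -
  have [simp]: "f \<in> Arr C" "g \<in> Arr C" using assms by (auto simp: monic_def)
  show ?thesis unfolding monic_def
  proof (intro conjI ballI impI)
    fix x y
    assume H: "x \<in> Arr C" "y \<in> Arr C" "Cod C x = Dom C (g \<cdot> f)" "Cod C y = Dom C (g \<cdot> f)"
      "(g \<cdot> f) \<cdot> x = (g \<cdot> f) \<cdot> y"
    then have "f \<cdot> x = f \<cdot> y" using assms(3) by - (rule monicD[OF assms(2)], simp_all)
    then show "x = y" using H assms(3) by - (rule monicD[OF assms(1)], simp_all)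
  qed (simp add: assms(3))
qed

lemma iso_monic: "is_iso C f \<Longrightarrow> monic C f"
  unfolding monic_def
proof (intro conjI ballI impI)
  fix x y
  assume H: "is_iso C f" "x \<in> Arr C" "y \<in> Arr C" "Cod C x = Dom C f" "Cod C y = Dom C f"
    "f \<cdot> x = f \<cdot> y"
  have "inverse_arr C f \<cdot> f \<cdot> x = inverse_arr C f \<cdot> f \<cdot> y" using H(6) by simp
  then show "x = y" using H(1-5) by simp
qed (rule iso_Arr)

lemma lifts_uniquelyD:
  assumes "lifts_uniquely C k x"
  shows "lift C k x \<in> Arr C" "Dom C (lift C k x) = Dom C x" "Cod C (lift C k x) = Dom C k"
    "k \<cdot> lift C k x = x"
proof -
  have "is_lift C k x (lift C k x)"
    using assms unfolding lifts_uniquely_def lift_def by (rule theI')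
  then show "lift C k x \<in> Arr C" "Dom C (lift C k x) = Dom C x" "Cod C (lift C k x) = Dom C k"
    "k \<cdot> lift C k x = x"
    by (auto simp: is_lift_def hom_def)
qed

lemma colifts_uniquelyD:
  assumes "colifts_uniquely C q x"
  shows "colift C q x \<in> Arr C" "Dom C (colift C q x) = Cod C q" "Cod C (colift C q x) = Cod C x"
    "colift C q x \<cdot> q = x"
proof -
  have "is_colift C q x (colift C q x)"
    using assms unfolding colifts_uniquely_def colift_def by (rule theI')
  then show "colift C q x \<in> Arr C" "Dom C (colift C q x) = Cod C q"
    "Cod C (colift C q x) = Cod C x" "colift C q x \<cdot> q = x"
    by (auto simp: is_colift_def hom_def)
qed

lemma lifts_uniquelyI:
  assumes "monic C k" "y \<in> Arr C" "Dom C y = Dom C x" "Cod C y = Dom C k" "k \<cdot> y = x"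
  shows "lifts_uniquely C k x" "lift C k x = y"
proof -
  have y: "is_lift C k x y" using assms by (auto simp: is_lift_def hom_def)
  have u: "z = y" if "is_lift C k x z" for z
    using that assms by (auto simp: is_lift_def hom_def dest: monicD[OF assms(1)])
  show "lifts_uniquely C k x" unfolding lifts_uniquely_def using y u by blast
  show "lift C k x = y" unfolding lift_def using y u by blast
qed

end

text \<open>The record type carries no extension, so that \<open>opp\<close> applies to the
  structure and its dual is again an instance.\<close>

locale chosen_homological = homological_category C + chosen_limits C
  for C :: "('o, 'm) chosen_category" (structure)

text \<open>The axioms come in dual pairs, such as closure under composition for kernels and for
  cokernels. The subquotient axiom is its own dual, with \<open>i\<close> and \<open>q\<close>
  exchanged.\<close>

lemma opp_chosen_homological:
  assumes "chosen_homological C"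
  shows "chosen_homological (opp C)"
proof -
  interpret chosen_homological C by fact
  show ?thesis
  proof (unfold_locales, goal_cases)
    case (5 f W X g Y h Z)
    then show ?case using Comp_assoc[of h Z Y g X f W] by simp
  next
    case (9 g W X f Y h Z)
    then show ?case using Null_ideal[of h Z Y f X g W] by (simp add: hom_def)
  next
    case (10 f X Y)
    then show ?case using Null_closed[of f Y X] by simp metis
  next
    case (13 f i g j)
    then show ?case using cokernel_comp[of g j f i] by simp
  next
    case (14 f p g q)
    then show ?case using kernel_comp[of g q f p] by simp
  next
    case (15 f i g q ci kq)
    then show ?case using subquotient[of g q f i kq ci] by simp metis
  qed (use Null_sub Ident_in Comp_in Comp_Ident Ident_Comp ex_kernel ex_cokernel
      Ker_kernel Coker_cokernel Pb_pullback Po_pushout in \<open>simp_all\<close>)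
qed

section \<open>Kernels and cokernels\<close>

context chosen_homological
begin

lemmas dual = opp_chosen_homological[OF chosen_homological_axioms]

lemma null_Arr [simp]: "f \<in> Null C \<Longrightarrow> f \<in> Arr C"
  using Null_sub by auto

lemma null_comp_left [simp]:
  assumes "f \<in> Null C" "h \<in> Arr C" "Cod C f = Dom C h"
  shows "h \<cdot> f \<in> Null C"
  using Null_ideal[of "Ident C (Dom C f)" "Dom C f" "Dom C f" f "Cod C f" h "Cod C h"] assms
  by (auto simp: hom_def)

lemma null_comp_right [simp]:
  assumes "f \<in> Null C" "h \<in> Arr C" "Cod C h = Dom C f"
  shows "f \<cdot> h \<in> Null C"
  using chosen_homological.null_comp_left[OF dual, of f h] assms by simp

lemma null_comp_mid:
  assumes "g \<cdot> f \<in> Null C" "f \<in> Arr C" "g \<in> Arr C" "x \<in> Arr C" "Cod C f = Dom C g"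
    "Cod C x = Dom C f"
  shows "g \<cdot> (f \<cdot> x) \<in> Null C"
  using null_comp_right[of "g \<cdot> f" x] assms by simp

lemma kernel_Arr:
  assumes "is_kernel C f k"
  shows "f \<in> Arr C" "k \<in> Arr C" "Cod C k = Dom C f" "f \<cdot> k \<in> Null C"
  using assms by (auto simp: is_kernel_def)

lemma cokernel_Arr:
  assumes "is_cokernel C f k"
  shows "f \<in> Arr C" "k \<in> Arr C" "Dom C k = Cod C f" "k \<cdot> f \<in> Null C"
  using assms by (auto simp: is_cokernel_def)

lemma kernel_factor:
  assumes "is_kernel C f k" "x \<in> Arr C" "Cod C x = Dom C f" "f \<cdot> x \<in> Null C"
  obtains y where "y \<in> Arr C" "Dom C y = Dom C x" "Cod C y = Dom C k" "k \<cdot> y = x"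
proof -
  from assms have "\<exists>y. is_lift C k x y" unfolding is_kernel_def lifts_uniquely_def by blast
  with that show thesis by (auto simp: is_lift_def hom_def)
qed

text \<open>Arrows with the same composite with \<open>k\<close> are both liftings of that
  composite. It is killed by \<open>f\<close> because \<open>k\<close> is, so its lifting is
  unique.\<close>

lemma kernel_monic:
  assumes "is_kernel C f k"
  shows "monic C k"
  unfolding monic_def
proof (intro conjI ballI impI)
  note [simp] = kernel_Arr[OF assms]
  fix x y
  assume H: "x \<in> Arr C" "y \<in> Arr C" "Cod C x = Dom C k" "Cod C y = Dom C k" "k \<cdot> x = k \<cdot> y"
  have "Dom C (k \<cdot> x) = Dom C (k \<cdot> y)" using H(5) by simp
  then have d: "Dom C y = Dom C x" using H(1-4) by simp
  have "f \<cdot> (k \<cdot> x) \<in> Null C" using null_comp_mid[of f k x] H by simp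
  then have "lifts_uniquely C k (k \<cdot> x)" using assms H by (auto simp: is_kernel_def)
  moreover have "is_lift C k (k \<cdot> x) x" "is_lift C k (k \<cdot> x) y"
    using H d by (auto simp: is_lift_def hom_def)
  ultimately show "x = y" by (auto simp: lifts_uniquely_def)
qed (rule kernel_Arr[OF assms])

text \<open>Closedness of the ideal enters here: \<open>k \<cdot> x\<close> factors through a null
  object, whose arrow into the codomain of \<open>k\<close> is null and so lifts through
  \<open>k\<close>. Cancelling \<open>k\<close>, the arrow \<open>x\<close> factors through that
  null object too.\<close>

lemma kernel_reflects_null:
  assumes "is_kernel C f k" "k \<cdot> x \<in> Null C" "x \<in> Arr C" "Cod C x = Dom C k"
  shows "x \<in> Null C"
proof -
  note [simp] = kernel_Arr[OF assms(1)] and assms(3,4)[simp]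
  obtain E p q where E: "null_object C E" "p \<in> hom C (Dom C x) E" "q \<in> hom C E (Cod C k)"
    "k \<cdot> x = q \<cdot> p"
    using Null_closed[of "k \<cdot> x" "Dom C x" "Cod C k"] assms(2) by (auto simp: hom_def)
  have [simp]: "p \<in> Arr C" "q \<in> Arr C" "Dom C p = Dom C x" "Cod C p = E" "Dom C q = E"
    "Cod C q = Dom C f" and n: "Ident C E \<in> Null C"
    using E by (auto simp: hom_def null_object_def)
  have "q \<in> Null C" using null_comp_left[OF n, of q] E by (simp add: null_object_def)
  then have "f \<cdot> q \<in> Null C" by simp
  then obtain y where y: "y \<in> Arr C" "Dom C y = E" "Cod C y = Dom C k" "k \<cdot> y = q"
    using kernel_factor[OF assms(1), of q] by auto
  note [simp] = y(1-3)
  have "k \<cdot> x = k \<cdot> (y \<cdot> p)" using E(4) comp_assoc_subst[OF y(4), of p] by simp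
  then have "x = y \<cdot> p" by (rule monicD[OF kernel_monic[OF assms(1)]]) simp_all
  moreover have "p \<in> Null C" using null_comp_right[OF n, of p] E by (simp add: null_object_def)
  ultimately show ?thesis by simp
qed

lemma cokernel_factor:
  assumes "is_cokernel C f k" "x \<in> Arr C" "Dom C x = Cod C f" "x \<cdot> f \<in> Null C"
  obtains y where "y \<in> Arr C" "Dom C y = Cod C k" "Cod C y = Cod C x" "y \<cdot> k = x"
  using chosen_homological.kernel_factor[OF dual, of f k x thesis] assms by simp

lemma cokernel_epic: "is_cokernel C f k \<Longrightarrow> epic C k"
  using chosen_homological.kernel_monic[OF dual, of f k] by simp

lemma cokernel_reflects_null:
  assumes "is_cokernel C f k" "x \<cdot> k \<in> Null C" "x \<in> Arr C" "Dom C x = Cod C k"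
  shows "x \<in> Null C"
  using chosen_homological.kernel_reflects_null[OF dual, of f k x] assms by simp

lemma is_kernelI:
  assumes "f \<in> Arr C" "k \<in> Arr C" "Cod C k = Dom C f" "f \<cdot> k \<in> Null C" "monic C k"
    "\<And>x. x \<in> Arr C \<Longrightarrow> Cod C x = Dom C f \<Longrightarrow> f \<cdot> x \<in> Null C \<Longrightarrow>
      \<exists>y \<in> Arr C. Dom C y = Dom C x \<and> Cod C y = Dom C k \<and> k \<cdot> y = x"
  shows "is_kernel C f k"
  using assms lifts_uniquelyI(1)[OF assms(5)] unfolding is_kernel_def by metis

lemma is_cokernelI:
  assumes "f \<in> Arr C" "k \<in> Arr C" "Dom C k = Cod C f" "k \<cdot> f \<in> Null C" "epic C k"
    "\<And>x. x \<in> Arr C \<Longrightarrow> Dom C x = Cod C f \<Longrightarrow> x \<cdot> f \<in> Null C \<Longrightarrow>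
      \<exists>y \<in> Arr C. Dom C y = Cod C k \<and> Cod C y = Cod C x \<and> y \<cdot> k = x"
  shows "is_cokernel C f k"
  using chosen_homological.is_kernelI[OF dual, of f k] assms by auto

lemma Ker_typing [simp]:
  assumes "f \<in> Arr C"
  shows "ker f \<in> Arr C" "Cod C (ker f) = Dom C f" "f \<cdot> ker f \<in> Null C"
  using kernel_Arr[OF Ker_kernel[OF assms]] by auto

lemma Coker_typing [simp]:
  assumes "f \<in> Arr C"
  shows "coker f \<in> Arr C" "Dom C (coker f) = Cod C f" "coker f \<cdot> f \<in> Null C"
  using cokernel_Arr[OF Coker_cokernel[OF assms]] by auto

lemma Ker_monic [simp]: "f \<in> Arr C \<Longrightarrow> monic C (ker f)"
  using kernel_monic Ker_kernel by blast

lemma Coker_epic [simp]: "f \<in> Arr C \<Longrightarrow> epic C (coker f)"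
  using cokernel_epic Coker_cokernel by blast

lemma Ker_reflects_null:
  assumes "ker f \<cdot> x \<in> Null C" "f \<in> Arr C" "x \<in> Arr C" "Cod C x = Dom C (ker f)"
  shows "x \<in> Null C"
  using kernel_reflects_null[OF Ker_kernel] assms by blast

lemma Coker_reflects_null:
  assumes "x \<cdot> coker f \<in> Null C" "f \<in> Arr C" "x \<in> Arr C" "Dom C x = Cod C (coker f)"
  shows "x \<in> Null C"
  using cokernel_reflects_null[OF Coker_cokernel] assms by blast

lemma kernel_lift:
  assumes "is_kernel C f k" "x \<in> Arr C" "Cod C x = Dom C f" "f \<cdot> x \<in> Null C"
  shows "lifts_uniquely C k x" "lift C k x \<in> Arr C" "Dom C (lift C k x) = Dom C x"
    "Cod C (lift C k x) = Dom C k" "k \<cdot> lift C k x = x"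
proof -
  obtain y where y: "y \<in> Arr C" "Dom C y = Dom C x" "Cod C y = Dom C k" "k \<cdot> y = x"
    using kernel_factor[OF assms] by metis
  note u = lifts_uniquelyI[OF kernel_monic[OF assms(1)] y]
  show "lifts_uniquely C k x" "lift C k x \<in> Arr C" "Dom C (lift C k x) = Dom C x"
    "Cod C (lift C k x) = Dom C k" "k \<cdot> lift C k x = x"
    using u y by simp_all
qed

lemma cokernel_colift:
  assumes "is_cokernel C f k" "x \<in> Arr C" "Dom C x = Cod C f" "x \<cdot> f \<in> Null C"
  shows "colifts_uniquely C k x" "colift C k x \<in> Arr C" "Cod C (colift C k x) = Cod C x"
    "Dom C (colift C k x) = Cod C k" "colift C k x \<cdot> k = x"
  using chosen_homological.kernel_lift[OF dual, of f k x] assms by simp_all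

lemma colifts_uniquelyI:
  assumes "epic C k" "y \<in> Arr C" "Cod C y = Cod C x" "Dom C y = Cod C k" "y \<cdot> k = x"
  shows "colifts_uniquely C k x" "colift C k x = y"
  using category.lifts_uniquelyI[of "opp C" k y x] chosen_homological.axioms(1)[OF dual] assms
  by (simp_all add: homological_category_def semiexact_category_def closed_ideal_category_def)

lemma epic_comp: "epic C f \<Longrightarrow> epic C g \<Longrightarrow> Cod C f = Dom C g \<Longrightarrow> epic C (g \<cdot> f)"
  using category.monic_comp[of "opp C" g f] chosen_homological.axioms(1)[OF dual]
  by (simp add: homological_category_def semiexact_category_def closed_ideal_category_def)

lemma kernels_iso:
  assumes "is_kernel C f k" "is_kernel C f k'"
  obtains e where "is_iso C e" "Dom C e = Dom C k" "Cod C e = Dom C k'" "k' \<cdot> e = k"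
proof -
  note [simp] = kernel_Arr[OF assms(1)] kernel_Arr[OF assms(2)]
  obtain e where e: "e \<in> Arr C" "Dom C e = Dom C k" "Cod C e = Dom C k'" "k' \<cdot> e = k"
    using kernel_factor[OF assms(2), of k] by auto
  obtain d where d: "d \<in> Arr C" "Dom C d = Dom C k'" "Cod C d = Dom C k" "k \<cdot> d = k'"
    using kernel_factor[OF assms(1), of k'] by auto
  note [simp] = e d comp_assoc_subst[OF e(4)] comp_assoc_subst[OF d(4)]
  have "d \<cdot> e = Ident C (Dom C k)" by (rule monicD[OF kernel_monic[OF assms(1)]]) simp_all
  moreover have "e \<cdot> d = Ident C (Dom C k')"
    by (rule monicD[OF kernel_monic[OF assms(2)]]) simp_all
  ultimately have "is_iso C e" by (intro is_isoI[of e d]) simp_all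
  with that e show ?thesis by blast
qed

lemma cokernels_iso:
  assumes "is_cokernel C f k" "is_cokernel C f k'"
  obtains e where "is_iso C e" "Cod C e = Cod C k" "Dom C e = Cod C k'" "e \<cdot> k' = k"
  using chosen_homological.kernels_iso[OF dual, of f k k' thesis] assms by simp

text \<open>Since \<open>f\<close> kills \<open>k\<close>, it factors through \<open>q\<close>; an
  arrow killed by \<open>q\<close> is therefore killed by \<open>f\<close> and lifts through
  \<open>k\<close>.\<close>

lemma kernel_of_coker:
  assumes "is_kernel C f k" "is_cokernel C k q"
  shows "is_kernel C q k"
proof (rule is_kernelI)
  note [simp] = kernel_Arr[OF assms(1)] cokernel_Arr[OF assms(2)]
  obtain y where y: "y \<in> Arr C" "Dom C y = Cod C q" "Cod C y = Cod C f" "y \<cdot> q = f"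
    using cokernel_factor[OF assms(2), of f] by auto
  fix x assume x: "x \<in> Arr C" "Cod C x = Dom C q" "q \<cdot> x \<in> Null C"
  have "f \<cdot> x = y \<cdot> (q \<cdot> x)" using x y by (simp add: comp_assoc_subst[OF y(4)])
  also have "\<dots> \<in> Null C" using x y by simp
  finally show "\<exists>y \<in> Arr C. Dom C y = Dom C x \<and> Cod C y = Dom C k \<and> k \<cdot> y = x"
    using kernel_factor[OF assms(1), of x] x by simp metis
qed (use kernel_Arr[OF assms(1)] cokernel_Arr[OF assms(2)] kernel_monic[OF assms(1)] in simp_all)

lemma cokernel_of_ker: "is_cokernel C f k \<Longrightarrow> is_kernel C k q \<Longrightarrow> is_cokernel C q k"
  using chosen_homological.kernel_of_coker[OF dual, of f k q] by simp

end

section \<open>Subquotients\<close>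

definition comm_sq :: "('o, 'm, 'z) category_scheme \<Rightarrow> 'm square \<Rightarrow> bool" where
  "comm_sq C S \<longleftrightarrow> {s_top S, s_left S, s_right S, s_bottom S} \<subseteq> Arr C \<and>
     Dom C (s_top S) = Dom C (s_left S) \<and> Cod C (s_top S) = Dom C (s_right S) \<and>
     Cod C (s_left S) = Dom C (s_bottom S) \<and> Cod C (s_right S) = Cod C (s_bottom S) \<and>
     s_right S \<cdot>\<^bsub>C\<^esub> s_top S = s_bottom S \<cdot>\<^bsub>C\<^esub> s_left S"

lemma opp_comm_sq [simp]: "comm_sq (opp C) (flip S) = comm_sq C S"
  by (auto simp: comm_sq_def)

lemma is_pullback_sym:
  assumes "is_pullback C f g p q"
  shows "is_pullback C g f q p"
proof -
  have "Dom C q = Dom C p" using assms by (simp add: is_pullback_def hom_def)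
  moreover have "\<exists>!z. z \<in> hom C X (Dom C p) \<and> q \<cdot>\<^bsub>C\<^esub> z = x \<and> p \<cdot>\<^bsub>C\<^esub> z = y"
    if "x \<in> hom C X (Dom C g)" "y \<in> hom C X (Dom C f)" "g \<cdot>\<^bsub>C\<^esub> x = f \<cdot>\<^bsub>C\<^esub> y" for X x y
  proof -
    have "\<exists>!z. z \<in> hom C X (Dom C p) \<and> p \<cdot>\<^bsub>C\<^esub> z = y \<and> q \<cdot>\<^bsub>C\<^esub> z = x"
      using assms that unfolding is_pullback_def by simp
    then show ?thesis by (simp add: conj_commute)
  qed
  ultimately show ?thesis using assms unfolding is_pullback_def by simp
qed

context chosen_homological
begin

text \<open>A kernel depends on \<open>f\<close> only through the arrows that \<open>f\<close>
  kills. This later allows \<open>bch\<close> to replace \<open>coker (ker bch)\<close>.\<close>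

lemma is_kernel_cong:
  assumes "is_kernel C f k" "f' \<in> Arr C" "Dom C f' = Dom C f"
    "\<And>x. x \<in> Arr C \<Longrightarrow> Cod C x = Dom C f \<Longrightarrow> f \<cdot> x \<in> Null C \<longleftrightarrow> f' \<cdot> x \<in> Null C"
  shows "is_kernel C f' k"
  using assms(1-3) assms(4)[of k] assms(4) unfolding is_kernel_def by simp

lemma is_cokernel_cong:
  assumes "is_cokernel C f k" "f' \<in> Arr C" "Cod C f' = Cod C f"
    "\<And>x. x \<in> Arr C \<Longrightarrow> Dom C x = Cod C f \<Longrightarrow> x \<cdot> f \<in> Null C \<longleftrightarrow> x \<cdot> f' \<in> Null C"
  shows "is_cokernel C f' k"
  using assms(1-3) assms(4)[of k] assms(4) unfolding is_cokernel_def by simp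

lemma kernel_iso_comp:
  assumes "is_kernel C (g \<cdot> e) k" "is_iso C e" "g \<in> Arr C" "Cod C e = Dom C g"
  shows "is_kernel C g (e \<cdot> k)"
proof -
  note [simp] = iso_Arr[OF assms(2)] assms(2,3) assms(4)
  note [simp] = kernel_Arr[OF assms(1)]
  have n: "g \<cdot> e \<cdot> k \<in> Null C" using kernel_Arr(4)[OF assms(1)] by simp
  have m: "monic C (e \<cdot> k)"
    by (rule monic_comp[OF kernel_monic[OF assms(1)] iso_monic[OF assms(2)]]) simp
  show ?thesis
  proof (rule is_kernelI)
    fix x assume x: "x \<in> Arr C" "Cod C x = Dom C g" "g \<cdot> x \<in> Null C"
    obtain y where y: "y \<in> Arr C" "Dom C y = Dom C x" "Cod C y = Dom C k"
      "k \<cdot> y = inverse_arr C e \<cdot> x"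
      using kernel_factor[OF assms(1), of "inverse_arr C e \<cdot> x"] x by auto
    then show "\<exists>y \<in> Arr C. Dom C y = Dom C x \<and> Cod C y = Dom C (e \<cdot> k) \<and> (e \<cdot> k) \<cdot> y = x"
      using x by (intro bexI[of _ y]) auto
  qed (use n m in simp_all)
qed

lemma cokernel_iso_comp:
  assumes "is_cokernel C (e \<cdot> g) k" "is_iso C e" "g \<in> Arr C" "Dom C e = Cod C g"
  shows "is_cokernel C g (k \<cdot> e)"
  using chosen_homological.kernel_iso_comp[OF dual, of g e k] assms by simp

text \<open>As \<open>f\<close> is null, the identity of its domain lifts through \<open>k\<close>;
  so \<open>k\<close> is monic with a right inverse.\<close>

lemma kernel_of_null_iso:
  assumes "is_kernel C f k" "f \<in> Null C"
  shows "is_iso C k"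
proof -
  note [simp] = kernel_Arr[OF assms(1)]
  obtain y where y: "y \<in> Arr C" "Dom C y = Dom C f" "Cod C y = Dom C k"
    "k \<cdot> y = Ident C (Dom C f)"
    using kernel_factor[OF assms(1), of "Ident C (Dom C f)"] assms(2) by auto
  note [simp] = y comp_assoc_subst[OF y(4)]
  have "y \<cdot> k = Ident C (Dom C k)" by (rule monicD[OF kernel_monic[OF assms(1)]]) simp_all
  then show ?thesis by (intro is_isoI[of k y]) simp_all
qed

section \<open>Normal factorization and exact morphisms\<close>

lemma im_typing [simp]:
  assumes "f \<in> Arr C"
  shows "im C f \<in> Arr C" "Cod C (im C f) = Cod C f" "monic C (im C f)"
    "is_kernel C (coker f) (im C f)"
  using assms Ker_kernel[of "coker f"] by (simp_all add: im_def)

lemma coim_typing [simp]: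
  assumes "f \<in> Arr C"
  shows "coim C f \<in> Arr C" "Dom C (coim C f) = Dom C f" "epic C (coim C f)"
    "is_cokernel C (ker f) (coim C f)"
  using assms Coker_cokernel[of "ker f"] by (simp_all add: coim_def)

text \<open>The lifting \<open>u\<close> of \<open>f\<close> through its image still kills
  \<open>ker f\<close>, because the image reflects nullity, so it descends to the coimage.
  Uniqueness cancels the monic image and the epic coimage.\<close>

lemma is_bar_ex1:
  assumes "f \<in> Arr C"
  shows "\<exists>!y. is_bar C f y"
proof (rule ex_ex1I)
  note [simp] = assms
  obtain u where u: "u \<in> Arr C" "Dom C u = Dom C f" "Cod C u = Dom C (im C f)" "im C f \<cdot> u = f"
    using kernel_factor[of "coker f" "im C f" f] by auto
  note [simp] = u comp_assoc_subst[OF u(4)]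
  have "u \<cdot> ker f \<in> Null C" by (rule kernel_reflects_null[of "coker f" "im C f"]) simp_all
  then obtain y where y: "y \<in> Arr C" "Dom C y = Cod C (coim C f)" "Cod C y = Cod C u"
    "y \<cdot> coim C f = u"
    using cokernel_factor[of "ker f" "coim C f" u] by auto
  show "\<exists>y. is_bar C f y" unfolding is_bar_def hom_def using y by (intro exI[of _ y]) simp
next
  note [simp] = assms
  fix y z assume H: "is_bar C f y" "is_bar C f z"
  have [simp]: "y \<in> Arr C" "z \<in> Arr C" "Dom C y = Cod C (coim C f)" "Cod C y = Dom C (im C f)"
    "Dom C z = Cod C (coim C f)" "Cod C z = Dom C (im C f)"
    using H by (auto simp: is_bar_def hom_def)
  have "y \<cdot> coim C f = z \<cdot> coim C f"
    by (rule monicD[of "im C f"]) (use H in \<open>simp_all add: is_bar_def\<close>)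
  then show "y = z" by (rule epicD[of "coim C f", rotated]) simp_all
qed

lemma bar_typing [simp]:
  assumes "f \<in> Arr C"
  shows "bar C f \<in> Arr C" "Dom C (bar C f) = Cod C (coim C f)" "Cod C (bar C f) = Dom C (im C f)"
    "im C f \<cdot> bar C f \<cdot> coim C f = f"
proof -
  have "is_bar C f (bar C f)" unfolding bar_def by (rule theI'[OF is_bar_ex1[OF assms]])
  then show "bar C f \<in> Arr C" "Dom C (bar C f) = Cod C (coim C f)"
    "Cod C (bar C f) = Dom C (im C f)" "im C f \<cdot> bar C f \<cdot> coim C f = f"
    by (auto simp: is_bar_def hom_def)
qed

lemma bar_comp [simp]:
  assumes "f \<in> Arr C" "x \<in> Arr C" "Cod C x = Dom C f"
  shows "im C f \<cdot> bar C f \<cdot> coim C f \<cdot> x = f \<cdot> x"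
  using comp_assoc[of x "bar C f \<cdot> coim C f" "im C f"] assms by simp

text \<open>The two descriptions bracket the threefold composite differently, and associativity
  applies to typed arrows.\<close>

lemma opp_bar [simp]:
  assumes "f \<in> Arr C"
  shows "bar (opp C) f = bar C f"
proof -
  have "is_bar (opp C) f = is_bar C f"
    using assms by (auto simp: is_bar_def hom_def fun_eq_iff)
  then show ?thesis by (simp add: bar_def)
qed

lemma opp_exact [simp]: "exact_arr (opp C) f = exact_arr C f"
  by (auto simp: exact_arr_def)

lemma exact_Arr: "exact_arr C f \<Longrightarrow> f \<in> Arr C" "exact_arr C f \<Longrightarrow> is_iso C (bar C f)"
  by (simp_all add: exact_arr_def)

text \<open>The cokernel of \<open>q\<close> is null, so the image of \<open>q\<close> is
  invertible; and \<open>q\<close> is its own coimage up to an isomorphism. Only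
  \<open>bar C q\<close> is left between them.\<close>

lemma cokernel_exact:
  assumes "is_cokernel C f q"
  shows "is_iso C (im C q)" "exact_arr C q"
proof -
  note [simp] = cokernel_Arr[OF assms]
  have "coker q \<in> Null C" by (rule cokernel_reflects_null[OF assms]) simp_all
  then show i: "is_iso C (im C q)" using kernel_of_null_iso[of "coker q" "im C q"] by simp
  obtain e where e: "is_iso C e" "Cod C e = Cod C (coim C q)" "Dom C e = Cod C q" "e \<cdot> q = coim C q"
    using cokernels_iso[of "ker q" "coim C q" q] cokernel_of_ker[OF assms Ker_kernel] by auto
  note [simp] = e(1-3) iso_Arr[OF e(1)] iso_Arr[OF i] i
  \<comment> \<open>Since \<open>e \<cdot> q\<close> is the coimage, the left side is the normal
    factorization of \<open>q\<close>; cancelling \<open>q\<close> then exhibits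
    \<open>bar C q\<close> as a composite of inverses.\<close>
  have *: "(im C q \<cdot> bar C q \<cdot> e) \<cdot> q = Ident C (Cod C q) \<cdot> q"
    using bar_typing(4)[of q] by (simp add: e(4))
  have l: "im C q \<cdot> bar C q \<cdot> e = Ident C (Cod C q)"
    by (rule epicD[OF cokernel_epic[OF assms] *]) simp_all
  have "bar C q \<cdot> e = inverse_arr C (im C q) \<cdot> im C q \<cdot> bar C q \<cdot> e"
    by simp
  also have "\<dots> = inverse_arr C (im C q)" unfolding l by simp
  finally have "bar C q = inverse_arr C (im C q) \<cdot> inverse_arr C e"
    using comp_assoc[of "inverse_arr C e" e "bar C q"] by simp
  then have "is_iso C (bar C q)" using iso_comp iso_inverse_arr e(1) i by simp
  then show "exact_arr C q" by (simp add: exact_arr_def)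
qed

lemma kernel_exact:
  assumes "is_kernel C f k"
  shows "is_iso C (coim C k)" "exact_arr C k"
  using chosen_homological.cokernel_exact[OF dual, of f k] assms by simp_all

text \<open>The subquotient axiom only says that \<open>p\<close> is a cokernel of some unknown
  \<open>x\<close>. To recognize it as a cokernel of \<open>phi\<close>, two things are needed:
  \<open>p\<close> kills \<open>phi\<close>, and whatever kills \<open>phi\<close> kills
  \<open>x\<close>. The second uses that kernels compose.\<close>

lemma subquotient_cokernel:
  assumes l: "is_kernel C g l" and r: "is_cokernel C f r"
    and phi: "phi \<in> Arr C" "Cod C phi = Dom C l" "l \<cdot> phi = f"
    and p: "is_cokernel C x p" and j: "is_kernel C y j" "Cod C p = Dom C j" "r \<cdot> l = j \<cdot> p"
  shows "is_cokernel C phi p"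
proof -
  have fphi: "Dom C f = Dom C phi" "Cod C f = Cod C l"
    unfolding phi(3)[symmetric] using phi(1,2) kernel_Arr[OF l] by simp_all
  note [simp] = kernel_Arr[OF l] cokernel_Arr[OF r] phi cokernel_Arr[OF p] kernel_Arr[OF j(1)]
    j(2)
  have "Dom C (r \<cdot> l) = Dom C (j \<cdot> p)" using j(3) by simp
  then have [simp]: "Cod C x = Dom C l" using fphi by simp
  define s where "s = ker (coker phi)"
  have [simp]: "s \<in> Arr C" "Cod C s = Dom C l" and sk: "is_kernel C (coker phi) s"
    using Ker_kernel[of "coker phi"] by (simp_all add: s_def)
  obtain phi1 where phi1: "phi1 \<in> Arr C" "Dom C phi1 = Dom C phi" "Cod C phi1 = Dom C s"
      "s \<cdot> phi1 = phi"
    using kernel_factor[OF sk, of phi] by auto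
  note [simp] = phi1(1-3)
  have "r \<cdot> l \<cdot> phi = j \<cdot> p \<cdot> phi"
    using comp_assoc_subst[OF j(3), of phi] fphi by simp
  then have "j \<cdot> p \<cdot> phi \<in> Null C" using cokernel_Arr(4)[OF r] phi(3) by metis
  then have np: "p \<cdot> phi \<in> Null C" by (rule kernel_reflects_null[OF j(1)]) simp_all
  \<comment> \<open>Kernels compose, so \<open>l \<cdot> s\<close> is the kernel of some \<open>w\<close>; as \<open>w\<close> kills \<open>f\<close>, it factors
    through \<open>r\<close>, whence everything killed by \<open>r \<cdot> l\<close> lies in \<open>s\<close>.\<close>
  obtain w where w: "is_kernel C w (l \<cdot> s)" using kernel_comp[OF sk l] by auto
  have [simp]: "w \<in> Arr C" "Dom C w = Dom C g" using kernel_Arr[OF w] by simp_all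
  have "(w \<cdot> l \<cdot> s) \<cdot> phi1 \<in> Null C" using kernel_Arr(4)[OF w] by (rule null_comp_right) simp_all
  then have "w \<cdot> f \<in> Null C" by (simp add: phi1(4))
  then obtain w' where w': "w' \<in> Arr C" "Dom C w' = Cod C r" "Cod C w' = Cod C w" "w' \<cdot> r = w"
    using cokernel_factor[OF r, of w] fphi by auto
  have "j \<cdot> p \<cdot> x \<in> Null C" by simp
  then have "r \<cdot> l \<cdot> x \<in> Null C" using comp_assoc_subst[OF j(3), of x] fphi by simp
  then have "w' \<cdot> r \<cdot> l \<cdot> x \<in> Null C" using w' fphi by simp
  then have "w \<cdot> l \<cdot> x \<in> Null C" using comp_assoc_subst[OF w'(4), of "l \<cdot> x"] w' fphi by simp
  then obtain x' where x': "x' \<in> Arr C" "Dom C x' = Dom C x" "Cod C x' = Dom C s"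
      "(l \<cdot> s) \<cdot> x' = l \<cdot> x"
    using kernel_factor[OF w, of "l \<cdot> x"] by auto
  have sx: "s \<cdot> x' = x"
    by (rule monicD[OF kernel_monic[OF l]]) (use x' in simp_all)
  show ?thesis
  proof (rule is_cokernelI)
    fix z assume z: "z \<in> Arr C" "Dom C z = Cod C phi" "z \<cdot> phi \<in> Null C"
    \<comment> \<open>An arrow \<open>z\<close> killing \<open>phi\<close> kills its image
      \<open>s\<close>, hence also \<open>x\<close>, which factors through \<open>s\<close>.\<close>
    obtain z' where z': "z' \<in> Arr C" "Dom C z' = Cod C (coker phi)" "Cod C z' = Cod C z"
        "z' \<cdot> coker phi = z"
      using cokernel_factor[of phi "coker phi" z] Coker_cokernel[of phi] z by auto
    have "z' \<cdot> (coker phi \<cdot> s) \<in> Null C"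
      using kernel_Arr(4)[OF sk] z' by simp
    then have "z \<cdot> s \<in> Null C"
      using comp_assoc_subst[OF z'(4), of s] z' by simp
    then have "z \<cdot> x \<in> Null C"
      using null_comp_mid[of z s x'] x' z sx by simp
    then show "\<exists>y \<in> Arr C. Dom C y = Cod C p \<and> Cod C y = Cod C z \<and> y \<cdot> p = z"
      using cokernel_factor[OF p, of z] z by simp metis
  qed (use np cokernel_epic[OF p] in simp_all)
qed

lemma subquotient_iso:
  assumes l: "is_kernel C g l" and r: "is_cokernel C f r"
    and phi: "phi \<in> Arr C" "Cod C phi = Dom C l" "l \<cdot> phi = f"
    and gam: "gam \<in> Arr C" "Dom C gam = Cod C r" "gam \<cdot> r = g"
    and p: "is_cokernel C phi p" and j: "is_kernel C gam j"
  obtains m where "is_iso C m" "Dom C m = Cod C p" "Cod C m = Dom C j" "j \<cdot> m \<cdot> p = r \<cdot> l"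
proof -
  have fphi: "Dom C f = Dom C phi" "Cod C f = Cod C l"
    unfolding phi(3)[symmetric] using phi(1,2) kernel_Arr[OF l] by simp_all
  note [simp] = kernel_Arr[OF l] cokernel_Arr[OF r] phi gam cokernel_Arr[OF p] kernel_Arr[OF j]
  \<comment> \<open>As \<open>f\<close> factors through \<open>l\<close>, it is killed by
    \<open>coker l\<close>, which therefore factors through \<open>r\<close> and kills
    \<open>ker r\<close>: this is the hypothesis of the subquotient axiom.\<close>
  have "coker l \<cdot> f \<in> Null C"
    using null_comp_mid[of "coker l" l phi] Coker_typing(3)[of l] phi(3)
    by (simp add: null_comp_right[of "coker l \<cdot> l" phi, simplified])
  then obtain z where z: "z \<in> Arr C" "Dom C z = Cod C r" "Cod C z = Cod C (coker l)"
    "z \<cdot> r = coker l"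
    using cokernel_factor[OF r, of "coker l"] fphi by auto
  have "z \<cdot> r \<cdot> ker r \<in> Null C" using z by simp
  then have "coker l \<cdot> ker r \<in> Null C"
    using comp_assoc_subst[OF z(4), of "ker r"] z by simp
  with l r obtain H p1 j1 x y where H: "p1 \<in> hom C (Dom C l) H" "is_cokernel C x p1"
    "j1 \<in> hom C H (Cod C r)" "is_kernel C y j1" "r \<cdot> l = j1 \<cdot> p1"
    using subquotient[of g l f r "coker l" "ker r"] Coker_cokernel[of l] Ker_kernel[of r] fphi
    by auto
  have Ht: "p1 \<in> Arr C" "j1 \<in> Arr C" "Cod C p1 = Dom C j1" using H by (auto simp: hom_def)
  have p1: "is_cokernel C phi p1"
    by (rule subquotient_cokernel[OF l r phi H(2,4)]) (use H Ht in simp_all)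
  \<comment> \<open>In the opposite category \<open>l\<close> and \<open>r\<close> trade places, and
    so do \<open>phi\<close> and \<open>gam\<close>.\<close>
  have j1: "is_kernel C gam j1"
    using chosen_homological.subquotient_cokernel[OF dual, of f r g l gam y j1 x p1] l r gam H Ht by simp
  obtain e where e: "is_iso C e" "Cod C e = Cod C p1" "Dom C e = Cod C p" "e \<cdot> p = p1"
    using cokernels_iso[OF p1 p] by blast
  obtain d where d: "is_iso C d" "Dom C d = Dom C j1" "Cod C d = Dom C j" "j \<cdot> d = j1"
    using kernels_iso[OF j1 j] by blast
  note [simp] = Ht iso_Arr[OF e(1)] iso_Arr[OF d(1)] e(2,3) d(2,3)
  show thesis
  proof (rule that)
    show "is_iso C (d \<cdot> e)" using e d by (intro iso_comp) simp_all
    show "j \<cdot> (d \<cdot> e) \<cdot> p = r \<cdot> l" using H(5) by (simp add: e(4) comp_assoc_subst[OF d(4)])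
  qed simp_all
qed

end

section \<open>Squares and Lambek morphisms\<close>

context chosen_homological
begin

text \<open>If \<open>f \<cdot> x = k \<cdot> y\<close>, then \<open>g \<cdot> f\<close> kills
  \<open>x\<close> because \<open>g\<close> kills \<open>k\<close>; so \<open>x\<close> factors
  through \<open>p\<close>. The other component is forced because \<open>k\<close> is monic.\<close>

lemma pullback_of_kernel:
  assumes k: "is_kernel C g k" and f: "f \<in> Arr C" "Cod C f = Cod C k"
    and p: "is_kernel C (g \<cdot> f) p"
  shows "is_pullback C f k p (lift C k (f \<cdot> p))"
proof -
  note [simp] = kernel_Arr[OF k] f
  have [simp]: "p \<in> Arr C" "Cod C p = Dom C f" "g \<cdot> f \<cdot> p \<in> Null C"
    using kernel_Arr[OF p] by simp_all
  define q where "q = lift C k (f \<cdot> p)"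
  have q [simp]: "q \<in> Arr C" "Dom C q = Dom C p" "Cod C q = Dom C k" "k \<cdot> q = f \<cdot> p"
    using kernel_lift[OF k, of "f \<cdot> p"] by (simp_all add: q_def)
  have "\<exists>!z. z \<in> hom C X (Dom C p) \<and> p \<cdot> z = x \<and> q \<cdot> z = y"
    if xy: "x \<in> hom C X (Dom C f)" "y \<in> hom C X (Dom C k)" "f \<cdot> x = k \<cdot> y" for X x y
  proof (rule ex_ex1I)
    have [simp]: "x \<in> Arr C" "y \<in> Arr C" "Dom C x = X" "Dom C y = X" "Cod C x = Dom C f"
      "Cod C y = Dom C k"
      using xy by (auto simp: hom_def)
    have "g \<cdot> k \<cdot> y \<in> Null C" by (rule null_comp_mid) simp_all
    then obtain z where z: "z \<in> Arr C" "Dom C z = X" "Cod C z = Dom C p" "p \<cdot> z = x"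
      using kernel_factor[OF p, of x] xy by auto
    have "k \<cdot> q \<cdot> z = k \<cdot> y"
      using z xy(3) comp_assoc_subst[OF q(4), of z] by simp
    then have "q \<cdot> z = y" by (rule monicD[OF kernel_monic[OF k]]) (use z in simp_all)
    with z show "\<exists>z. z \<in> hom C X (Dom C p) \<and> p \<cdot> z = x \<and> q \<cdot> z = y"
      by (auto simp: hom_def)
  next
    fix z z' assume "z \<in> hom C X (Dom C p) \<and> p \<cdot> z = x \<and> q \<cdot> z = y"
      "z' \<in> hom C X (Dom C p) \<and> p \<cdot> z' = x \<and> q \<cdot> z' = y"
    then show "z = z'" by - (rule monicD[OF kernel_monic[OF p]], auto simp: hom_def)
  qed
  then show ?thesis unfolding q_def[symmetric] is_pullback_def by (simp add: hom_def)
qed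

text \<open>The chosen pullback is arbitrary, so its projection has to be recognized as a kernel
  from the universal property alone.\<close>

lemma kernel_of_pullback:
  assumes k: "is_kernel C g k" and P: "is_pullback C f k p q"
  shows "is_kernel C (g \<cdot> f) p"
proof -
  note [simp] = kernel_Arr[OF k]
  have t [simp]: "f \<in> Arr C" "p \<in> Arr C" "q \<in> Arr C" "Cod C f = Dom C g" "Dom C q = Dom C p"
    "Cod C p = Dom C f" "Cod C q = Dom C k" "f \<cdot> p = k \<cdot> q"
    using P by (auto simp: is_pullback_def hom_def)
  have U: "\<exists>!z. z \<in> hom C X (Dom C p) \<and> p \<cdot> z = x \<and> q \<cdot> z = y"
    if "x \<in> hom C X (Dom C f)" "y \<in> hom C X (Dom C k)" "f \<cdot> x = k \<cdot> y" for X x y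
    using P that unfolding is_pullback_def by blast
  have n: "g \<cdot> k \<cdot> q \<in> Null C" by (rule null_comp_mid) simp_all
  show ?thesis
  proof (rule is_kernelI)
    show "monic C p" unfolding monic_def
    proof (intro conjI ballI impI)
      fix x y assume xy: "x \<in> Arr C" "y \<in> Arr C" "Cod C x = Dom C p" "Cod C y = Dom C p"
        "p \<cdot> x = p \<cdot> y"
      have "Dom C (p \<cdot> x) = Dom C (p \<cdot> y)" using xy(5) by simp
      then have d: "Dom C y = Dom C x" using xy(1-4) by simp
      have "k \<cdot> q \<cdot> x = f \<cdot> p \<cdot> x" "k \<cdot> q \<cdot> y = f \<cdot> p \<cdot> y"
        using xy(1-4) comp_assoc_subst[OF t(8)] by simp_all
      then have "q \<cdot> x = q \<cdot> y" using xy by - (rule monicD[OF kernel_monic[OF k]], simp_all)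
      moreover have "f \<cdot> p \<cdot> x = k \<cdot> q \<cdot> x" using xy(1-4) comp_assoc_subst[OF t(8)] by simp
      then have "\<exists>!z. z \<in> hom C (Dom C x) (Dom C p) \<and> p \<cdot> z = p \<cdot> x \<and> q \<cdot> z = q \<cdot> x"
        using xy d by (intro U) (simp_all add: hom_def)
      moreover have "x \<in> hom C (Dom C x) (Dom C p)" "y \<in> hom C (Dom C x) (Dom C p)"
        using xy d by (simp_all add: hom_def)
      ultimately show "x = y" using xy(5) by metis
    qed simp
  next
    fix x assume x: "x \<in> Arr C" "Cod C x = Dom C (g \<cdot> f)" "(g \<cdot> f) \<cdot> x \<in> Null C"
    obtain y where y: "y \<in> Arr C" "Dom C y = Dom C x" "Cod C y = Dom C k" "k \<cdot> y = f \<cdot> x"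
      using kernel_factor[OF k, of "f \<cdot> x"] x by auto
    then have "\<exists>!z. z \<in> hom C (Dom C x) (Dom C p) \<and> p \<cdot> z = x \<and> q \<cdot> z = y"
      using x by (intro U) (simp_all add: hom_def)
    then show "\<exists>y \<in> Arr C. Dom C y = Dom C x \<and> Cod C y = Dom C p \<and> p \<cdot> y = x"
      by (auto simp: hom_def)
  qed (use n in simp_all)
qed

section \<open>Lambek invariants of a commutative square\<close>

lemma comm_sqD:
  assumes "comm_sq C S"
  shows "s_top S \<in> Arr C" "s_left S \<in> Arr C" "s_right S \<in> Arr C" "s_bottom S \<in> Arr C"
    "Dom C (s_left S) = Dom C (s_top S)" "Cod C (s_top S) = Dom C (s_right S)"
    "Cod C (s_left S) = Dom C (s_bottom S)" "Cod C (s_right S) = Cod C (s_bottom S)"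
    "s_bottom S \<cdot> s_left S = s_right S \<cdot> s_top S"
  using assms by (auto simp: comm_sq_def)

text \<open>An image is a kernel, so some pullback exists; the choice function is then bound to
  return one.\<close>

lemma sq_pullback:
  assumes "comm_sq C S"
  shows "is_pullback C (im C (s_right S)) (im C (s_bottom S)) (sq_pr1 C S) (sq_pr2 C S)"
proof -
  note [simp] = comm_sqD[OF assms]
  have "is_pullback C (im C (s_right S)) (im C (s_bottom S))
      (ker (coker (s_bottom S) \<cdot> im C (s_right S)))
      (lift C (im C (s_bottom S))
        (im C (s_right S) \<cdot> ker (coker (s_bottom S) \<cdot> im C (s_right S))))"
    by (rule pullback_of_kernel[OF im_typing(4)]) (simp_all add: Ker_kernel)
  from Pb_pullback[OF this] show ?thesis by (simp add: sq_pr1_def sq_pr2_def)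
qed

lemma sq_pr_typing:
  assumes "comm_sq C S"
  shows "sq_pr1 C S \<in> Arr C" "Cod C (sq_pr1 C S) = Dom C (im C (s_right S))"
    "sq_pr2 C S \<in> Arr C" "Cod C (sq_pr2 C S) = Dom C (im C (s_bottom S))"
    "Dom C (sq_pr2 C S) = Dom C (sq_pr1 C S)"
    "im C (s_right S) \<cdot> sq_pr1 C S = im C (s_bottom S) \<cdot> sq_pr2 C S"
  using sq_pullback[OF assms] by (auto simp: is_pullback_def hom_def)

lemma sq_pr_kernel:
  assumes "comm_sq C S"
  shows "is_kernel C (coker (s_bottom S) \<cdot> im C (s_right S)) (sq_pr1 C S)"
    "is_kernel C (coker (s_right S) \<cdot> im C (s_bottom S)) (sq_pr2 C S)"
  using kernel_of_pullback[OF im_typing(4) sq_pullback[OF assms]]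
    kernel_of_pullback[OF im_typing(4) is_pullback_sym[OF sq_pullback[OF assms]]]
    comm_sqD[OF assms] by blast+

lemma is_sq_lam_ex1:
  assumes "comm_sq C S"
  shows "\<exists>!x. is_sq_lam C S x"
proof -
  note [simp] = comm_sqD[OF assms]
  define x where "x = bar C (s_right S) \<cdot> coim C (s_right S) \<cdot> s_top S"
  define y where "y = bar C (s_bottom S) \<cdot> coim C (s_bottom S) \<cdot> s_left S"
  have "x \<in> hom C (Dom C (s_top S)) (Dom C (im C (s_right S)))"
    "y \<in> hom C (Dom C (s_top S)) (Dom C (im C (s_bottom S)))"
    "im C (s_right S) \<cdot> x = im C (s_bottom S) \<cdot> y"
    by (simp_all add: x_def y_def hom_def)
  then show ?thesis
    using sq_pullback[OF assms]
    unfolding is_pullback_def is_sq_lam_def x_def[symmetric] y_def[symmetric] by blast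
qed

lemma sq_Im_definedI: "comm_sq C S \<Longrightarrow> sq_Im_defined C S"
  unfolding sq_Im_defined_def using sq_pullback is_sq_lam_ex1 by blast

lemma sq_lam_typing:
  assumes "comm_sq C S"
  shows "sq_lam C S \<in> Arr C" "Dom C (sq_lam C S) = Dom C (s_top S)"
    "Cod C (sq_lam C S) = Dom C (sq_pr1 C S)"
    "sq_pr1 C S \<cdot> sq_lam C S = bar C (s_right S) \<cdot> coim C (s_right S) \<cdot> s_top S"
    "sq_pr2 C S \<cdot> sq_lam C S = bar C (s_bottom S) \<cdot> coim C (s_bottom S) \<cdot> s_left S"
proof -
  have "is_sq_lam C S (sq_lam C S)" unfolding sq_lam_def by (rule theI'[OF is_sq_lam_ex1[OF assms]])
  then show "sq_lam C S \<in> Arr C" "Dom C (sq_lam C S) = Dom C (s_top S)"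
    "Cod C (sq_lam C S) = Dom C (sq_pr1 C S)"
    "sq_pr1 C S \<cdot> sq_lam C S = bar C (s_right S) \<cdot> coim C (s_right S) \<cdot> s_top S"
    "sq_pr2 C S \<cdot> sq_lam C S = bar C (s_bottom S) \<cdot> coim C (s_bottom S) \<cdot> s_left S"
    by (auto simp: is_sq_lam_def hom_def)
qed

lemma sq_in_typing:
  assumes "comm_sq C S"
  shows "sq_in1 C S \<in> Arr C" "Dom C (sq_in1 C S) = Cod C (coim C (s_left S))"
    "sq_in2 C S \<in> Arr C" "Dom C (sq_in2 C S) = Cod C (coim C (s_top S))"
    "Cod C (sq_in2 C S) = Cod C (sq_in1 C S)"
    "sq_in1 C S \<cdot> coim C (s_left S) = sq_in2 C S \<cdot> coim C (s_top S)"
  using chosen_homological.sq_pr_typing[OF dual, of "flip S"] assms by simp_all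

lemma sq_in_cokernel:
  assumes "comm_sq C S"
  shows "is_cokernel C (coim C (s_left S) \<cdot> ker (s_top S)) (sq_in1 C S)"
    "is_cokernel C (coim C (s_top S) \<cdot> ker (s_left S)) (sq_in2 C S)"
  using chosen_homological.sq_pr_kernel[OF dual, of "flip S"] assms by simp_all

text \<open>Reflection turns the images of the right and bottom sides into the coimages of the left
  and top sides. Commutativity supplies the typing needed for rebracketing.\<close>

lemma opp_is_sq_lam:
  assumes "comm_sq C S"
  shows "is_sq_lam (opp C) (flip S) = is_sq_rho C S"
  using comm_sqD[OF assms] sq_in_typing[OF assms]
  by (auto simp: is_sq_lam_def is_sq_rho_def fun_eq_iff)

lemma opp_sq_lam: "comm_sq C S \<Longrightarrow> sq_lam (opp C) (flip S) = sq_rho C S"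
  by (simp add: sq_lam_def sq_rho_def opp_is_sq_lam)

lemma opp_is_sq_rho:
  assumes "comm_sq C S"
  shows "is_sq_rho (opp C) (flip S) = is_sq_lam C S"
  using comm_sqD[OF assms] sq_pr_typing[OF assms]
  by (auto simp: is_sq_lam_def is_sq_rho_def fun_eq_iff)

lemma opp_sq_rho: "comm_sq C S \<Longrightarrow> sq_rho (opp C) (flip S) = sq_lam C S"
  by (simp add: sq_lam_def sq_rho_def opp_is_sq_rho)

lemma sq_Ker_definedI: "comm_sq C S \<Longrightarrow> sq_Ker_defined C S"
  using chosen_homological.sq_Im_definedI[OF dual, of "flip S"]
  by (simp add: sq_Im_defined_def sq_Ker_defined_def opp_is_sq_lam)

lemma opp_sq_Im_defined: "comm_sq C S \<Longrightarrow> sq_Im_defined (opp C) (flip S) = sq_Ker_defined C S"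
  "comm_sq C S \<Longrightarrow> sq_Ker_defined (opp C) (flip S) = sq_Im_defined C S"
  by (simp_all add: sq_Im_defined_def sq_Ker_defined_def opp_is_sq_lam opp_is_sq_rho)

lemma sq_rho_typing:
  assumes "comm_sq C S"
  shows "sq_rho C S \<in> Arr C" "Cod C (sq_rho C S) = Cod C (s_bottom S)"
    "Dom C (sq_rho C S) = Cod C (sq_in1 C S)"
    "sq_rho C S \<cdot> sq_in1 C S = s_bottom S \<cdot> im C (s_left S) \<cdot> bar C (s_left S)"
    "sq_rho C S \<cdot> sq_in2 C S = s_right S \<cdot> im C (s_top S) \<cdot> bar C (s_top S)"
  using chosen_homological.sq_lam_typing[OF dual, of "flip S"] assms comm_sqD[OF assms]
  by (simp_all add: opp_sq_lam)

text \<open>Since \<open>r \<cdot> l\<close> kills \<open>phi\<close> it descends along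
  \<open>coker phi\<close>; the result is killed by \<open>gam\<close> because a cokernel reflects
  nullity, so it lifts through \<open>ker gam\<close>. Lambek morphisms and the homology isomorphism
  both get their existence and uniqueness from this.\<close>

lemma null_pair_factor:
  assumes "l \<in> Arr C" "r \<in> Arr C" "Cod C l = Dom C r"
    and phi: "phi \<in> Arr C" "Cod C phi = Dom C l" "r \<cdot> l \<cdot> phi \<in> Null C"
    and gam: "gam \<in> Arr C" "Dom C gam = Cod C r" "gam \<cdot> r \<cdot> l \<in> Null C"
  shows "\<exists>!m. m \<in> hom C (Cod C (coker phi)) (Dom C (ker gam)) \<and> r \<cdot> l = ker gam \<cdot> m \<cdot> coker phi"
proof (rule ex_ex1I)
  note [simp] = assms
  obtain y where y: "y \<in> Arr C" "Dom C y = Cod C (coker phi)" "Cod C y = Cod C r"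
    "y \<cdot> coker phi = r \<cdot> l"
    using cokernel_factor[OF Coker_cokernel, of phi "r \<cdot> l"] by auto
  have "gam \<cdot> y \<in> Null C"
    by (rule cokernel_reflects_null[OF Coker_cokernel[OF phi(1)]]) (use y in simp_all)
  then obtain m where "m \<in> Arr C" "Dom C m = Dom C y" "Cod C m = Dom C (ker gam)"
    "ker gam \<cdot> m = y"
    using kernel_factor[OF Ker_kernel, of gam y] y by auto
  note m = this comp_assoc_subst[OF this(4)]
  show "\<exists>m. m \<in> hom C (Cod C (coker phi)) (Dom C (ker gam)) \<and> r \<cdot> l = ker gam \<cdot> m \<cdot> coker phi"
    using m y by (intro exI[of _ m]) (simp add: hom_def)
next
  note [simp] = assms
  fix m m'
  assume H: "m \<in> hom C (Cod C (coker phi)) (Dom C (ker gam)) \<and> r \<cdot> l = ker gam \<cdot> m \<cdot> coker phi"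
    "m' \<in> hom C (Cod C (coker phi)) (Dom C (ker gam)) \<and> r \<cdot> l = ker gam \<cdot> m' \<cdot> coker phi"
  then have [simp]: "m \<in> Arr C" "m' \<in> Arr C" "Dom C m = Cod C (coker phi)"
    "Dom C m' = Cod C (coker phi)" "Cod C m = Dom C (ker gam)" "Cod C m' = Dom C (ker gam)"
    by (auto simp: hom_def)
  have "m \<cdot> coker phi = m' \<cdot> coker phi"
    by (rule monicD[of "ker gam"]) (use H in simp_all)
  then show "m = m'" by (rule epicD[of "coker phi", rotated]) simp_all
qed

end

section \<open>Lambek morphisms of consecutive squares\<close>

context chosen_homological
begin

text \<open>The arrow \<open>f\<close> lifts through \<open>ker g\<close>, which the coimage of
  \<open>g\<close> kills.\<close>

lemma coim_comp_null:
  assumes "g \<cdot> f \<in> Null C" "f \<in> Arr C" "g \<in> Arr C" "Cod C f = Dom C g"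
  shows "coim C g \<cdot> f \<in> Null C"
proof -
  note [simp] = assms
  obtain y where y: "y \<in> Arr C" "Dom C y = Dom C f" "Cod C y = Dom C (ker g)" "ker g \<cdot> y = f"
    using kernel_factor[OF Ker_kernel, of g f] by auto
  have "coim C g \<cdot> ker g \<cdot> y \<in> Null C"
    using cokernel_Arr[OF coim_typing(4)[of g]] y by (intro null_comp_mid) simp_all
  then show ?thesis by (simp add: y(4))
qed

lemma comp_im_null:
  assumes "g \<cdot> f \<in> Null C" "f \<in> Arr C" "g \<in> Arr C" "Cod C f = Dom C g"
  shows "g \<cdot> im C f \<in> Null C"
  using chosen_homological.coim_comp_null[OF dual, of f g] assms by simp

lemma im_comp_null_iff:
  assumes "x \<in> Arr C" "y \<in> Arr C" "Dom C x = Cod C y"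
  shows "x \<cdot> im C y \<in> Null C \<longleftrightarrow> x \<cdot> y \<in> Null C"
proof
  assume "x \<cdot> im C y \<in> Null C"
  then have "x \<cdot> im C y \<cdot> bar C y \<cdot> coim C y \<in> Null C"
    using assms by (intro null_comp_mid) simp_all
  then show "x \<cdot> y \<in> Null C" using assms by simp
qed (use assms in \<open>auto intro: comp_im_null\<close>)

lemma coker_ker_comp_null_iff:
  assumes "x \<in> Arr C" "y \<in> Arr C" "Dom C x = Cod C y"
  shows "coker (ker x) \<cdot> y \<in> Null C \<longleftrightarrow> x \<cdot> y \<in> Null C"
proof
  assume "coker (ker x) \<cdot> y \<in> Null C"
  then have "(im C x \<cdot> bar C x) \<cdot> coim C x \<cdot> y \<in> Null C"
    using assms coim_typing[of x] unfolding coim_def[symmetric]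
    by (intro null_comp_left[of "coim C x \<cdot> y"]) simp_all
  then show "x \<cdot> y \<in> Null C" using assms by simp
qed (use assms coim_comp_null in \<open>auto simp: coim_def\<close>)

text \<open>The letters \<open>l\<close>, \<open>r\<close>, \<open>phi\<close>, \<open>gam\<close>
  stand for a projection, a coprojection, and the morphisms lambda and rho of the two squares, so
  that one argument serves both directions of stacking. Nullity suffices for existence; the kernel
  and cokernel hypotheses on \<open>l\<close> and \<open>r\<close> give invertibility.\<close>

lemma lambek_general:
  assumes b: "exact_arr C b"
    and f: "f \<in> Arr C" "Cod C f = Dom C b" and g: "g \<in> Arr C" "Dom C g = Cod C b"
    and l: "l \<in> Arr C" "Cod C l = Dom C (im C b)" and r: "r \<in> Arr C" "Dom C r = Cod C (coim C b)"
    and phi: "phi \<in> Arr C" "Cod C phi = Dom C l" "l \<cdot> phi = bar C b \<cdot> coim C b \<cdot> f"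
    and gam: "gam \<in> Arr C" "Dom C gam = Cod C r" "gam \<cdot> r = g \<cdot> im C b \<cdot> bar C b"
    and null: "r \<cdot> coim C b \<cdot> f \<in> Null C" "g \<cdot> im C b \<cdot> l \<in> Null C"
  shows "\<exists>!m. m \<in> hom C (Cod C (coker phi)) (Dom C (ker gam)) \<and>
      r \<cdot> inverse_arr C (bar C b) \<cdot> l = ker gam \<cdot> m \<cdot> coker phi"
    and "\<lbrakk>is_cokernel C (coim C b \<cdot> f) r; is_kernel C (g \<cdot> im C b) l;
      m \<in> hom C (Cod C (coker phi)) (Dom C (ker gam)) \<and>
      r \<cdot> inverse_arr C (bar C b) \<cdot> l = ker gam \<cdot> m \<cdot> coker phi\<rbrakk> \<Longrightarrow> is_iso C m"
proof -
  let ?P = "\<lambda>m. m \<in> hom C (Cod C (coker phi)) (Dom C (ker gam)) \<and>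
      r \<cdot> inverse_arr C (bar C b) \<cdot> l = ker gam \<cdot> m \<cdot> coker phi"
  note [simp] = exact_Arr[OF b] f g l r phi gam null comp_assoc_subst[OF phi(3)]
    comp_assoc_subst[OF gam(3)]
  have "r \<cdot> inverse_arr C (bar C b) \<cdot> l = (r \<cdot> inverse_arr C (bar C b)) \<cdot> l" by simp
  moreover have "\<exists>!m. m \<in> hom C (Cod C (coker phi)) (Dom C (ker gam)) \<and>
      (r \<cdot> inverse_arr C (bar C b)) \<cdot> l = ker gam \<cdot> m \<cdot> coker phi"
    by (rule null_pair_factor) simp_all
  ultimately show ex: "\<exists>!m. ?P m" by simp
  assume H: "is_cokernel C (coim C b \<cdot> f) r" "is_kernel C (g \<cdot> im C b) l" "?P m"
  \<comment> \<open>Exactness of \<open>b\<close> moves \<open>r\<close> from the coimage to the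
    image of \<open>b\<close>, so that \<open>l\<close> and the new cokernel meet at the same
    object.\<close>
  have r': "is_cokernel C (bar C b \<cdot> coim C b \<cdot> f) (r \<cdot> inverse_arr C (bar C b))"
    by (rule cokernel_iso_comp) (use H in \<open>simp_all add: iso_inverse_arr\<close>)
  obtain n where n: "is_iso C n" "Dom C n = Cod C (coker phi)" "Cod C n = Dom C (ker gam)"
      "ker gam \<cdot> n \<cdot> coker phi = (r \<cdot> inverse_arr C (bar C b)) \<cdot> l"
    by (rule subquotient_iso[OF H(2) r' _ _ _ _ _ _ Coker_cokernel Ker_kernel, of phi gam])
      simp_all
  then have "?P n" using iso_Arr[OF n(1)] by (simp add: hom_def)
  with ex H(3) have "n = m" by metis
  with n show "is_iso C m" by simp
qed

text \<open>The two premises of the isomorphism claim are the form in which exactness of the rows is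
  used: they say that \<open>sq_in1 C T\<close> and \<open>sq_pr1 C S\<close> are already determined
  by the outer arrows \<open>s_top S\<close> and \<open>s_bottom T\<close>.\<close>

lemma lambek_h:
  assumes S: "comm_sq C S" and T: "comm_sq C T" and ST: "s_left T = s_right S"
    and b: "exact_arr C (s_right S)"
    and null: "s_top T \<cdot> s_top S \<in> Null C" "s_bottom T \<cdot> s_bottom S \<in> Null C"
  shows "\<exists>!L. is_lambek_h C S T L"
    and "is_cokernel C (coim C (s_right S) \<cdot> s_top S) (sq_in1 C T) \<Longrightarrow>
      is_kernel C (s_bottom T \<cdot> im C (s_right S)) (sq_pr1 C S) \<Longrightarrow> is_iso C (lambek_h C S T)"
    and "is_lambek_h C S T (lambek_h C S T)"
proof -
  note [simp] = comm_sqD[OF S] comm_sqD[OF T, unfolded ST] sq_pr_typing[OF S]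
    sq_in_typing[OF T, unfolded ST] sq_lam_typing[OF S] sq_rho_typing[OF T, unfolded ST]
  note [simp] = comm_sqD(6)[OF T, symmetric]
  have ct: "Dom C (s_top T) = Cod C (s_top S)" "Dom C (s_bottom T) = Cod C (s_bottom S)"
    using comm_sqD[OF S] comm_sqD[OF T] ST by metis+
  note [simp] = ct[symmetric]
  \<comment> \<open>Crossing the pushout of \<open>T\<close> replaces the coimage of the common side
    by that of \<open>s_top T\<close>, which kills \<open>s_top S\<close>; crossing the pullback of
    \<open>S\<close> does the same for the bottom row.\<close>
  have "coim C (s_top T) \<cdot> s_top S \<in> Null C"
    by (rule coim_comp_null[OF null(1)]) simp_all
  then have n1: "sq_in1 C T \<cdot> coim C (s_right S) \<cdot> s_top S \<in> Null C"
    using comp_assoc_subst[OF sq_in_typing(6)[OF T, unfolded ST], of "s_top S"] by simp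
  have n2: "s_bottom T \<cdot> im C (s_bottom S) \<cdot> sq_pr2 C S \<in> Null C"
    by (rule null_comp_mid[OF comp_im_null[OF null(2)]]) simp_all
  note G = lambek_general[OF b, of "s_top S" "s_bottom T" "sq_pr1 C S" "sq_in1 C T" "sq_lam C S"
    "sq_rho C T"]
  show ex: "\<exists>!L. is_lambek_h C S T L"
    unfolding is_lambek_h_def sq_Im_def sq_Ker_def
    by (rule G(1)) (use n1 n2 in simp_all)
  then show L: "is_lambek_h C S T (lambek_h C S T)" unfolding lambek_h_def by (rule theI')
  assume "is_cokernel C (coim C (s_right S) \<cdot> s_top S) (sq_in1 C T)"
    "is_kernel C (s_bottom T \<cdot> im C (s_right S)) (sq_pr1 C S)"
  then show "is_iso C (lambek_h C S T)"
    using L unfolding is_lambek_h_def sq_Im_def sq_Ker_def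
    by - (rule G(2), use n1 n2 in simp_all)
qed

text \<open>Transposing the squares would not give this from the horizontal case: chosen pullbacks
  of the same two arrows in opposite orders are unrelated choices. It is a second instance of
  \<open>lambek_general\<close>, with the other projection and coprojection.\<close>

lemma lambek_v:
  assumes S: "comm_sq C S" and T: "comm_sq C T" and ST: "s_top T = s_bottom S"
    and b: "exact_arr C (s_bottom S)"
    and null: "s_left T \<cdot> s_left S \<in> Null C" "s_right T \<cdot> s_right S \<in> Null C"
  shows "\<exists>!L. is_lambek_v C S T L"
    and "is_cokernel C (coim C (s_bottom S) \<cdot> s_left S) (sq_in2 C T) \<Longrightarrow>
      is_kernel C (s_right T \<cdot> im C (s_bottom S)) (sq_pr2 C S) \<Longrightarrow> is_iso C (lambek_v C S T)"
    and "is_lambek_v C S T (lambek_v C S T)"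
proof -
  note [simp] = comm_sqD[OF S] comm_sqD[OF T, unfolded ST] sq_pr_typing[OF S]
    sq_in_typing[OF T, unfolded ST] sq_lam_typing[OF S] sq_rho_typing[OF T, unfolded ST]
  have "coim C (s_left T) \<cdot> s_left S \<in> Null C"
    by (rule coim_comp_null[OF null(1)]) simp_all
  then have "sq_in1 C T \<cdot> coim C (s_left T) \<cdot> s_left S \<in> Null C" by simp
  then have n1: "sq_in2 C T \<cdot> coim C (s_bottom S) \<cdot> s_left S \<in> Null C"
    using comp_assoc_subst[OF sq_in_typing(6)[OF T, unfolded ST], of "s_left S"] by simp
  have "s_right T \<cdot> im C (s_right S) \<cdot> sq_pr1 C S \<in> Null C"
    by (rule null_comp_mid[OF comp_im_null[OF null(2)]]) simp_all
  then have n2: "s_right T \<cdot> im C (s_bottom S) \<cdot> sq_pr2 C S \<in> Null C" by simp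
  note G = lambek_general[OF b, of "s_left S" "s_right T" "sq_pr2 C S" "sq_in2 C T" "sq_lam C S"
    "sq_rho C T"]
  show ex: "\<exists>!L. is_lambek_v C S T L"
    unfolding is_lambek_v_def sq_Im_def sq_Ker_def
    by (rule G(1)) (use n1 n2 in simp_all)
  then show L: "is_lambek_v C S T (lambek_v C S T)" unfolding lambek_v_def by (rule theI')
  assume "is_cokernel C (coim C (s_bottom S) \<cdot> s_left S) (sq_in2 C T)"
    "is_kernel C (s_right T \<cdot> im C (s_bottom S)) (sq_pr2 C S)"
  then show "is_iso C (lambek_v C S T)"
    using L unfolding is_lambek_v_def sq_Im_def sq_Ker_def
    by - (rule G(2), use n1 n2 in simp_all)
qed

text \<open>Exactness gives the inverse of \<open>bar C (s_right S)\<close> its typing, on which the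
  rebracketing of the defining equation depends.\<close>

lemma opp_lambek_h:
  assumes S: "comm_sq C S" and T: "comm_sq C T" and ST: "s_left T = s_right S"
    and b: "exact_arr C (s_right S)"
  shows "is_lambek_h (opp C) (flip T) (flip S) = is_lambek_h C S T"
    "lambek_h (opp C) (flip T) (flip S) = lambek_h C S T"
proof -
  note [simp] = comm_sqD[OF S] comm_sqD[OF T, unfolded ST] sq_pr_typing[OF S]
    sq_in_typing[OF T, unfolded ST] sq_lam_typing[OF S] sq_rho_typing[OF T, unfolded ST]
    exact_Arr[OF b] opp_sq_lam[OF T] opp_sq_rho[OF S]
  show "is_lambek_h (opp C) (flip T) (flip S) = is_lambek_h C S T"
    using ST by (auto simp: is_lambek_h_def sq_Im_def sq_Ker_def fun_eq_iff hom_def)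
  then show "lambek_h (opp C) (flip T) (flip S) = lambek_h C S T" by (simp add: lambek_h_def)
qed

lemma opp_lambek_v:
  assumes S: "comm_sq C S" and T: "comm_sq C T" and ST: "s_top T = s_bottom S"
    and b: "exact_arr C (s_bottom S)"
  shows "is_lambek_v (opp C) (flip T) (flip S) = is_lambek_v C S T"
    "lambek_v (opp C) (flip T) (flip S) = lambek_v C S T"
proof -
  note [simp] = comm_sqD[OF S] comm_sqD[OF T, unfolded ST] sq_pr_typing[OF S]
    sq_in_typing[OF T, unfolded ST] sq_lam_typing[OF S] sq_rho_typing[OF T, unfolded ST]
    exact_Arr[OF b] opp_sq_lam[OF T] opp_sq_rho[OF S]
  show "is_lambek_v (opp C) (flip T) (flip S) = is_lambek_v C S T"
    using ST by (auto simp: is_lambek_v_def sq_Im_def sq_Ker_def fun_eq_iff hom_def)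
  then show "lambek_v (opp C) (flip T) (flip S) = lambek_v C S T" by (simp add: lambek_v_def)
qed

end

section \<open>Two null rows with an exact vertical morphism\<close>

text \<open>The auxiliary arrows are parameters with defining equations, so that the locale can be
  entered twice with given names: by the diagram and by its opposite. In the latter
  \<open>fs'\<close>, \<open>bhat\<close>, \<open>xi'\<close>, \<open>eta'\<close> play the roles of
  \<open>gb\<close>, \<open>bch\<close>, \<open>xi\<close>, \<open>eta\<close>.\<close>

locale lambek_diagram = chosen_homological C
  for C :: "('o, 'm) chosen_category" (structure) +
  fixes f g f' g' a b c gb bch xi eta k k' v mu t :: 'm and S T S1 S2 :: "'m square"
  assumes arrs [simp]: "f \<in> Arr C" "g \<in> Arr C" "f' \<in> Arr C" "g' \<in> Arr C" "a \<in> Arr C" "b \<in> Arr C"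
      "c \<in> Arr C"
    and ends [simp]: "Dom C g = Cod C f" "Dom C b = Cod C f" "Dom C a = Dom C f" "Cod C a = Dom C f'"
      "Cod C b = Cod C f'" "Dom C g' = Cod C f'" "Dom C c = Cod C g" "Cod C c = Cod C g'"
    and comm [simp]: "f' \<cdot> a = b \<cdot> f" "c \<cdot> g = g' \<cdot> b"
    and null_rows [simp]: "g \<cdot> f \<in> Null C" "g' \<cdot> f' \<in> Null C"
    and b_exact [simp]: "exact_arr C b"
    and gb_def: "gb = colift C (coker f) g"
    and bch_def: "bch = colift C (coker f) (coker f' \<cdot> b)"
    and xi_def: "xi = lift C (ker bch) (coker f \<cdot> ker b)"
    and eta_def: "eta = lift C (ker c) (gb \<cdot> ker bch)"
    and k_def: "k = lift C (ker b) (f \<cdot> ker (b \<cdot> f))"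
    and k'_def: "k' = lift C (ker (eta \<cdot> xi)) k"
    and v_def: "v = lift C (ker eta) (xi \<cdot> ker (eta \<cdot> xi))"
    and S_def: "S = Square f a b f'"
    and T_def: "T = Square g b c g'"
    and S1_def: "S1 = Square (coker f) b bch (coker f')"
    and S2_def: "S2 = Square xi (ker b) (ker bch) (coker f)"
    and mu_def: "mu = lift C (sq_pr1 C S2) (bar C (ker bch) \<cdot> coim C (ker bch))"
    and t_def: "t = colift C (coker xi) (coker (sq_lam C S2) \<cdot> mu)"
begin

section \<open>The induced morphisms and alpha\<close>

lemma gb: "colifts_uniquely C (coker f) g" and gb_typing [simp]: "gb \<in> Arr C"
  "Cod C gb = Cod C g" "Dom C gb = Cod C (coker f)" and gb_eq [simp]: "gb \<cdot> coker f = g"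
  using cokernel_colift[OF Coker_cokernel, of f g] by (simp_all add: gb_def)

lemma bch: "colifts_uniquely C (coker f) (coker f' \<cdot> b)" and bch_typing [simp]: "bch \<in> Arr C"
  "Cod C bch = Cod C (coker f')" "Dom C bch = Cod C (coker f)"
  and bch_eq [simp]: "bch \<cdot> coker f = coker f' \<cdot> b"
proof -
  have "coker f' \<cdot> f' \<cdot> a \<in> Null C" by (rule null_comp_mid) simp_all
  then have "(coker f' \<cdot> b) \<cdot> f \<in> Null C" by simp
  then show "colifts_uniquely C (coker f) (coker f' \<cdot> b)" "bch \<in> Arr C"
    "Cod C bch = Cod C (coker f')" "Dom C bch = Cod C (coker f)" "bch \<cdot> coker f = coker f' \<cdot> b"
    using cokernel_colift[OF Coker_cokernel, of f "coker f' \<cdot> b"] by (simp_all add: bch_def)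
qed

lemmas gb_bch_subst [simp] = comp_assoc_subst[OF gb_eq] comp_assoc_subst[OF bch_eq]

lemma xi: "lifts_uniquely C (ker bch) (coker f \<cdot> ker b)" and xi_typing [simp]: "xi \<in> Arr C"
  "Dom C xi = Dom C (ker b)" "Cod C xi = Dom C (ker bch)"
  and xi_eq [simp]: "ker bch \<cdot> xi = coker f \<cdot> ker b"
  using kernel_lift[OF Ker_kernel, of bch "coker f \<cdot> ker b"] by (simp_all add: xi_def)

lemma eta: "lifts_uniquely C (ker c) (gb \<cdot> ker bch)" and eta_typing [simp]: "eta \<in> Arr C"
  "Dom C eta = Dom C (ker bch)" "Cod C eta = Dom C (ker c)"
  and eta_eq [simp]: "ker c \<cdot> eta = gb \<cdot> ker bch"
proof -
  \<comment> \<open>Here \<open>z\<close> is the morphism from the cokernel of \<open>f'\<close>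
    induced by \<open>g'\<close>; against the epic \<open>coker f\<close> one sees that
    \<open>c \<cdot> gb\<close> factors through \<open>bch\<close>, hence kills
    \<open>ker bch\<close>.\<close>
  obtain z where z [simp]: "z \<in> Arr C" "Dom C z = Cod C (coker f')" "Cod C z = Cod C g'"
      "z \<cdot> coker f' = g'"
    using cokernel_factor[OF Coker_cokernel, of f' g'] by auto
  have "c \<cdot> gb = z \<cdot> bch"
    by (rule epicD[of "coker f"]) (simp_all add: comp_assoc_subst[OF z(4)])
  from comp_assoc_subst[OF this, of "ker bch"] have "c \<cdot> gb \<cdot> ker bch = z \<cdot> bch \<cdot> ker bch"
    by simp
  then have "c \<cdot> gb \<cdot> ker bch \<in> Null C" by simp
  then show "lifts_uniquely C (ker c) (gb \<cdot> ker bch)" "eta \<in> Arr C"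
    "Dom C eta = Dom C (ker bch)" "Cod C eta = Dom C (ker c)" "ker c \<cdot> eta = gb \<cdot> ker bch"
    using kernel_lift[OF Ker_kernel, of c "gb \<cdot> ker bch"] by (simp_all add: eta_def)
qed

lemmas xi_eta_subst [simp] = comp_assoc_subst[OF xi_eq] comp_assoc_subst[OF eta_eq]

lemma k: "lifts_uniquely C (ker b) (f \<cdot> ker (b \<cdot> f))" and k_typing [simp]: "k \<in> Arr C"
  "Dom C k = Dom C (ker (b \<cdot> f))" "Cod C k = Dom C (ker b)"
  and k_eq [simp]: "ker b \<cdot> k = f \<cdot> ker (b \<cdot> f)"
proof -
  have "b \<cdot> f \<cdot> ker (b \<cdot> f) \<in> Null C" using Ker_typing(3)[of "b \<cdot> f"] by simp
  then show "lifts_uniquely C (ker b) (f \<cdot> ker (b \<cdot> f))" "k \<in> Arr C"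
  "Dom C k = Dom C (ker (b \<cdot> f))" "Cod C k = Dom C (ker b)" "ker b \<cdot> k = f \<cdot> ker (b \<cdot> f)"
    using kernel_lift[OF Ker_kernel, of b "f \<cdot> ker (b \<cdot> f)"] by (simp_all add: k_def)
qed

lemma xi_k_null [simp]: "xi \<cdot> k \<in> Null C"
proof (rule kernel_reflects_null[OF Ker_kernel])
  have "coker f \<cdot> f \<cdot> ker (b \<cdot> f) \<in> Null C" by (rule null_comp_mid) simp_all
  then show "ker bch \<cdot> xi \<cdot> k \<in> Null C" by simp
qed simp_all

lemma eta_xi_k_null: "(eta \<cdot> xi) \<cdot> k \<in> Null C"
  by simp

lemma k': "lifts_uniquely C (ker (eta \<cdot> xi)) k" and k'_typing [simp]: "k' \<in> Arr C"
  "Dom C k' = Dom C k" "Cod C k' = Dom C (ker (eta \<cdot> xi))"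
  and k'_eq [simp]: "ker (eta \<cdot> xi) \<cdot> k' = k"
  using kernel_lift[OF Ker_kernel, of "eta \<cdot> xi" k] by (simp_all add: k'_def)

lemma v: "lifts_uniquely C (ker eta) (xi \<cdot> ker (eta \<cdot> xi))" and v_typing [simp]: "v \<in> Arr C"
  "Dom C v = Dom C (ker (eta \<cdot> xi))" "Cod C v = Dom C (ker eta)"
  and v_eq [simp]: "ker eta \<cdot> v = xi \<cdot> ker (eta \<cdot> xi)"
proof -
  have "eta \<cdot> xi \<cdot> ker (eta \<cdot> xi) \<in> Null C" using Ker_typing(3)[of "eta \<cdot> xi"] by simp
  then show "lifts_uniquely C (ker eta) (xi \<cdot> ker (eta \<cdot> xi))" "v \<in> Arr C"
  "Dom C v = Dom C (ker (eta \<cdot> xi))" "Cod C v = Dom C (ker eta)"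
  "ker eta \<cdot> v = xi \<cdot> ker (eta \<cdot> xi)"
    using kernel_lift[OF Ker_kernel, of eta "xi \<cdot> ker (eta \<cdot> xi)"] by (simp_all add: v_def)
qed

lemma alpha: "colifts_uniquely C (coker k') v"
  and alpha_typing [simp]: "colift C (coker k') v \<in> Arr C"
  "Cod C (colift C (coker k') v) = Dom C (ker eta)"
  "Dom C (colift C (coker k') v) = Cod C (coker k')"
  and alpha_eq [simp]: "colift C (coker k') v \<cdot> coker k' = v"
proof -
  have "v \<cdot> k' \<in> Null C"
    by (rule kernel_reflects_null[OF Ker_kernel, of eta]) (simp_all add: comp_assoc_subst[OF v_eq])
  then show "colifts_uniquely C (coker k') v" "colift C (coker k') v \<in> Arr C"
  "Cod C (colift C (coker k') v) = Dom C (ker eta)"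
  "Dom C (colift C (coker k') v) = Cod C (coker k')" "colift C (coker k') v \<cdot> coker k' = v"
    using cokernel_colift[OF Coker_cokernel, of k' v] by simp_all
qed

section \<open>The auxiliary squares and beta\<close>

lemma comm_sqs [simp]: "comm_sq C S" "comm_sq C T" "comm_sq C S1" "comm_sq C S2"
  by (simp_all add: comm_sq_def S_def T_def S1_def S2_def)

lemma sq_sel [simp]:
  "s_top S = f" "s_left S = a" "s_right S = b" "s_bottom S = f'"
  "s_top T = g" "s_left T = b" "s_right T = c" "s_bottom T = g'"
  "s_top S1 = coker f" "s_left S1 = b" "s_right S1 = bch" "s_bottom S1 = coker f'"
  "s_top S2 = xi" "s_left S2 = ker b" "s_right S2 = ker bch" "s_bottom S2 = coker f"
  by (simp_all add: S_def T_def S1_def S2_def)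

lemma lambek_ST: "\<exists>!x. is_lambek_h C S T x" "is_lambek_h C S T (lambek_h C S T)"
  using lambek_h(1,3)[of S T] by simp_all

text \<open>The row formed by \<open>f\<close> and \<open>coker f\<close> is exact in the middle:
  the kernel of \<open>coker f\<close> is the image of \<open>f\<close>, and the same arrows kill
  \<open>f\<close> and its image.\<close>

lemma in1_S1_cokernel: "is_cokernel C (coim C b \<cdot> f) (sq_in1 C S1)"
proof -
  have "is_cokernel C (coim C b \<cdot> im C f) (sq_in1 C S1)"
    using sq_in_cokernel(1)[of S1] by (simp add: im_def)
  then show ?thesis
  proof (rule is_cokernel_cong)
    fix x assume "x \<in> Arr C" "Dom C x = Cod C (coim C b \<cdot> im C f)"
    then show "x \<cdot> coim C b \<cdot> im C f \<in> Null C \<longleftrightarrow> x \<cdot> coim C b \<cdot> f \<in> Null C"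
      using im_comp_null_iff[of "x \<cdot> coim C b" f] by simp
  qed simp_all
qed

text \<open>Both rows now end in a cokernel of their first arrow; for the lower one,
  \<open>sq_pr1 C S\<close> is directly the required kernel.\<close>

lemma lambek_SS1: "\<exists>!x. is_lambek_h C S S1 x" "is_iso C (lambek_h C S S1)"
  "is_lambek_h C S S1 (lambek_h C S S1)"
  using lambek_h[of S S1] in1_S1_cokernel sq_pr_kernel(1)[of S] by simp_all

lemma coker_f_exact [simp]: "exact_arr C (coker f)" "is_iso C (im C (coker f))"
  using cokernel_exact[OF Coker_cokernel, of f] by simp_all

lemma ker_bch_exact [simp]: "is_iso C (bar C (ker bch))" "is_iso C (coim C (ker bch))"
  using kernel_exact[OF Ker_kernel, of bch] by (simp_all add: exact_arr_def)

text \<open>This is exactness of the column formed by \<open>ker bch\<close> and \<open>bch\<close>: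
  the coimage of \<open>bch\<close> kills the same arrows as \<open>bch\<close>.\<close>

lemma pr2_S2_kernel: "is_kernel C (bch \<cdot> im C (coker f)) (sq_pr2 C S2)"
proof -
  have "is_kernel C (coker (ker bch) \<cdot> im C (coker f)) (sq_pr2 C S2)"
    using sq_pr_kernel(2)[of S2] by simp
  then show ?thesis
  proof (rule is_kernel_cong)
    fix x assume "x \<in> Arr C" "Cod C x = Dom C (coker (ker bch) \<cdot> im C (coker f))"
    then show "(coker (ker bch) \<cdot> im C (coker f)) \<cdot> x \<in> Null C \<longleftrightarrow>
        (bch \<cdot> im C (coker f)) \<cdot> x \<in> Null C"
      using coker_ker_comp_null_iff[of bch "im C (coker f) \<cdot> x"] by simp
  qed simp_all
qed

lemma lambek_S2S1: "\<exists>!x. is_lambek_v C S2 S1 x" "is_iso C (lambek_v C S2 S1)"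
  "is_lambek_v C S2 S1 (lambek_v C S2 S1)"
  using lambek_v[of S2 S1] pr2_S2_kernel sq_in_cokernel(2)[of S1] by simp_all

lemmas sq_typing [simp] =
  sq_pr_typing[OF comm_sqs(1), simplified] sq_lam_typing[OF comm_sqs(1), simplified]
  sq_pr_typing[OF comm_sqs(4), simplified] sq_lam_typing[OF comm_sqs(4), simplified]
  sq_in_typing[OF comm_sqs(2), simplified] sq_rho_typing[OF comm_sqs(2), simplified]
  sq_in_typing[OF comm_sqs(3), simplified] sq_rho_typing[OF comm_sqs(3), simplified]

text \<open>The bottom side of \<open>S2\<close> is a cokernel, so its own cokernel is null and
  \<open>sq_pr1 C S2\<close> is the kernel of a null arrow. This is what reduces the invariant of
  \<open>S2\<close> to the cokernel of \<open>xi\<close>.\<close>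

lemma pr1_S2_iso [simp]: "is_iso C (sq_pr1 C S2)"
proof (rule kernel_of_null_iso)
  show "is_kernel C (coker (coker f) \<cdot> im C (ker bch)) (sq_pr1 C S2)"
    using sq_pr_kernel(1)[of S2] by simp
  have "coker (coker f) \<in> Null C" by (rule cokernel_reflects_null[OF Coker_cokernel[of f]]) simp_all
  then show "coker (coker f) \<cdot> im C (ker bch) \<in> Null C" by (intro null_comp_right) simp_all
qed

text \<open>The kernel \<open>ker bch\<close> is exact with invertible coimage, so \<open>mu\<close>
  identifies its domain with the pullback object of \<open>S2\<close>.\<close>

lemma mu: "lifts_uniquely C (sq_pr1 C S2) (bar C (ker bch) \<cdot> coim C (ker bch))"
  and mu_iso [simp]: "is_iso C mu"
  and mu_typing [simp]: "mu \<in> Arr C" "Dom C mu = Dom C (ker bch)" "Cod C mu = Dom C (sq_pr1 C S2)"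
  and mu_eq [simp]: "sq_pr1 C S2 \<cdot> mu = bar C (ker bch) \<cdot> coim C (ker bch)"
proof -
  let ?y = "inverse_arr C (sq_pr1 C S2) \<cdot> bar C (ker bch) \<cdot> coim C (ker bch)"
  note u = lifts_uniquelyI[OF iso_monic[OF pr1_S2_iso], of ?y
      "bar C (ker bch) \<cdot> coim C (ker bch)"]
  show "lifts_uniquely C (sq_pr1 C S2) (bar C (ker bch) \<cdot> coim C (ker bch))"
    by (rule u) simp_all
  have "mu = ?y" unfolding mu_def by (rule u) simp_all
  then show "is_iso C mu" "mu \<in> Arr C" "Dom C mu = Dom C (ker bch)"
    "Cod C mu = Dom C (sq_pr1 C S2)" "sq_pr1 C S2 \<cdot> mu = bar C (ker bch) \<cdot> coim C (ker bch)"
    by (simp_all add: iso_comp iso_inverse_arr)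
qed

text \<open>Under the identification \<open>mu\<close>, the morphism lambda of \<open>S2\<close> is
  \<open>xi\<close>; hence their cokernels agree up to the isomorphism \<open>t\<close>.\<close>

lemma lam_S2: "sq_lam C S2 = mu \<cdot> xi"
  by (rule monicD[OF iso_monic[OF pr1_S2_iso]]) (simp_all add: comp_assoc_subst[OF mu_eq])

lemma t: "colifts_uniquely C (coker xi) (coker (sq_lam C S2) \<cdot> mu)" and t_iso: "is_iso C t"
  and t_typing [simp]: "t \<in> Arr C" "Dom C t = Cod C (coker xi)"
    "Cod C t = Cod C (coker (sq_lam C S2))"
  and t_eq: "t \<cdot> coker xi = coker (sq_lam C S2) \<cdot> mu"
proof -
  have q: "is_cokernel C xi (coker (sq_lam C S2) \<cdot> mu)"
    by (rule cokernel_iso_comp) (simp_all add: lam_S2[symmetric] Coker_cokernel)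
  obtain e where e: "is_iso C e" "Cod C e = Cod C (coker (sq_lam C S2) \<cdot> mu)"
      "Dom C e = Cod C (coker xi)" "e \<cdot> coker xi = coker (sq_lam C S2) \<cdot> mu"
    using cokernels_iso[OF q Coker_cokernel[OF xi_typing(1)]] by blast
  note u = colifts_uniquelyI[OF Coker_epic[OF xi_typing(1)], of e]
  have "t = e" unfolding t_def by (rule u) (use e iso_Arr in simp_all)
  with e iso_Arr[OF e(1)] show "is_iso C t" "t \<in> Arr C" "Dom C t = Cod C (coker xi)"
    "Cod C t = Cod C (coker (sq_lam C S2))" "t \<cdot> coker xi = coker (sq_lam C S2) \<cdot> mu"
    by simp_all
  show "colifts_uniquely C (coker xi) (coker (sq_lam C S2) \<cdot> mu)"
    by (rule u) (use e iso_Arr in simp_all)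
qed

lemma ST_typing [simp]: "lambek_h C S T \<in> Arr C"
    "Dom C (lambek_h C S T) = Cod C (coker (sq_lam C S))"
    "Cod C (lambek_h C S T) = Dom C (ker (sq_rho C T))"
  and ST_eq: "sq_in1 C T \<cdot> inverse_arr C (bar C b) \<cdot> sq_pr1 C S =
    ker (sq_rho C T) \<cdot> lambek_h C S T \<cdot> coker (sq_lam C S)"
  using lambek_ST(2) by (auto simp: is_lambek_h_def hom_def sq_Im_def sq_Ker_def)

lemma SS1_typing [simp]: "lambek_h C S S1 \<in> Arr C"
    "Dom C (lambek_h C S S1) = Cod C (coker (sq_lam C S))"
    "Cod C (lambek_h C S S1) = Dom C (ker (sq_rho C S1))"
  and SS1_eq: "sq_in1 C S1 \<cdot> inverse_arr C (bar C b) \<cdot> sq_pr1 C S =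
    ker (sq_rho C S1) \<cdot> lambek_h C S S1 \<cdot> coker (sq_lam C S)"
  using lambek_SS1(3) by (auto simp: is_lambek_h_def hom_def sq_Im_def sq_Ker_def)

lemma S2S1_typing [simp]: "lambek_v C S2 S1 \<in> Arr C"
    "Dom C (lambek_v C S2 S1) = Cod C (coker (sq_lam C S2))"
    "Cod C (lambek_v C S2 S1) = Dom C (ker (sq_rho C S1))"
  and S2S1_eq: "sq_in2 C S1 \<cdot> inverse_arr C (bar C (coker f)) \<cdot> sq_pr2 C S2 =
    ker (sq_rho C S1) \<cdot> lambek_v C S2 S1 \<cdot> coker (sq_lam C S2)"
  using lambek_S2S1(3) by (auto simp: is_lambek_v_def hom_def sq_Im_def sq_Ker_def)

text \<open>\<open>beta\<close> before the identification of \<open>Ker eta\<close> with \<open>Ker h\<close>.\<close>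

definition beta0 :: 'm where
  "beta0 = inverse_arr C (lambek_h C S S1) \<cdot> lambek_v C S2 S1 \<cdot> t \<cdot> coker xi \<cdot> ker eta"

lemma beta0_typing [simp]: "beta0 \<in> Arr C" "Dom C beta0 = Dom C (ker eta)"
  "Cod C beta0 = Cod C (coker (sq_lam C S))"
  using lambek_SS1(2) by (simp_all add: beta0_def)

text \<open>By the choice of \<open>v\<close>, the composite \<open>ker eta \<cdot> v\<close> starts
  with \<open>ker (eta \<cdot> xi)\<close> and ends with \<open>xi\<close>, which
  \<open>coker xi\<close> kills. The epic \<open>coker k'\<close> reflects nullity.\<close>

lemma beta0_alpha_null: "beta0 \<cdot> colift C (coker k') v \<in> Null C"
proof (rule cokernel_reflects_null[OF Coker_cokernel[OF k'_typing(1)]])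
  have "coker xi \<cdot> xi \<cdot> ker (eta \<cdot> xi) \<in> Null C" by (rule null_comp_mid) simp_all
  then show "(beta0 \<cdot> colift C (coker k') v) \<cdot> coker k' \<in> Null C"
    using lambek_SS1(2) by (simp add: beta0_def)
qed simp_all

end

section \<open>Canonical isomorphisms for homology and for cokernels of induced morphisms\<close>

context chosen_homological
begin

lemma homology_iso:
  assumes [simp]: "f \<in> Arr C" "g \<in> Arr C" "Dom C g = Cod C f" "g \<cdot> f \<in> Null C"
  shows "\<exists>!x. is_homology_iso C f g x"
    and "is_homology_iso C f g (homology_iso C f g)"
    and "is_iso C (homology_iso C f g)"
proof -
  define phi where "phi = lift C (ker g) f"
  define gam where "gam = colift C (coker f) g"
  have [simp]: "phi \<in> Arr C" "Cod C phi = Dom C (ker g)" "ker g \<cdot> phi = f"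
    using kernel_lift[OF Ker_kernel, of g f] by (simp_all add: phi_def)
  have [simp]: "gam \<in> Arr C" "Dom C gam = Cod C (coker f)" "gam \<cdot> coker f = g"
    using cokernel_colift[OF Coker_cokernel, of f g] by (simp_all add: gam_def)
  obtain n where n: "is_iso C n" "Dom C n = Cod C (coker phi)" "Cod C n = Dom C (ker gam)"
      "ker gam \<cdot> n \<cdot> coker phi = coker f \<cdot> ker g"
    by (rule subquotient_iso[OF Ker_kernel Coker_cokernel _ _ _ _ _ _ Coker_cokernel Ker_kernel,
          of g f phi gam]) simp_all
  have "gam \<cdot> coker f \<cdot> ker g \<in> Null C"
    using comp_assoc_subst[OF \<open>gam \<cdot> coker f = g\<close>, of "ker g"] by simp
  then have "\<exists>!x. x \<in> hom C (Cod C (coker phi)) (Dom C (ker gam)) \<and>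
      coker f \<cdot> ker g = ker gam \<cdot> x \<cdot> coker phi"
    by (intro null_pair_factor) simp_all
  then show ex: "\<exists>!x. is_homology_iso C f g x"
    by (simp add: is_homology_iso_def phi_def gam_def eq_commute)
  then show "is_homology_iso C f g (homology_iso C f g)"
    unfolding homology_iso_def by (rule theI')
  moreover have "is_homology_iso C f g n"
    using n iso_Arr[OF n(1)] by (simp add: is_homology_iso_def phi_def gam_def hom_def)
  ultimately have "homology_iso C f g = n" using ex by blast
  with n show "is_iso C (homology_iso C f g)" by simp
qed

lemma homology_iso_typing:
  assumes "f \<in> Arr C" "g \<in> Arr C" "Dom C g = Cod C f" "g \<cdot> f \<in> Null C"
  shows "homology_iso C f g \<in> Arr C"
    "Dom C (homology_iso C f g) = Cod C (coker (lift C (ker g) f))"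
    "Cod C (homology_iso C f g) = Dom C (ker (colift C (coker f) g))"
    "ker (colift C (coker f) g) \<cdot> homology_iso C f g \<cdot> coker (lift C (ker g) f) = coker f \<cdot> ker g"
  using homology_iso(2)[OF assms] by (auto simp: is_homology_iso_def hom_def)

lemma monics_lift_iso:
  assumes p: "monic C p" and q: "monic C q"
    and x: "x \<in> Arr C" "Dom C x = Dom C p" "Cod C x = Dom C q" "q \<cdot> x = p"
    and y: "y \<in> Arr C" "Dom C y = Dom C q" "Cod C y = Dom C p" "p \<cdot> y = q"
  shows "lifts_uniquely C q p" "is_iso C (lift C q p)"
proof -
  note [simp] = x y comp_assoc_subst[OF x(4)] comp_assoc_subst[OF y(4)]
  have [simp]: "p \<in> Arr C" "q \<in> Arr C" using p q by (auto simp: monic_def)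
  have "y \<cdot> x = Ident C (Dom C p)" by (rule monicD[OF p]) simp_all
  moreover have "x \<cdot> y = Ident C (Dom C q)" by (rule monicD[OF q]) simp_all
  ultimately have "is_iso C x" by (intro is_isoI[of x y]) simp_all
  with lifts_uniquelyI[OF q x(1-4)]
  show "lifts_uniquely C q p" "is_iso C (lift C q p)" by simp_all
qed

lemma epics_colift_iso:
  assumes p: "epic C p" and q: "epic C q"
    and x: "x \<in> Arr C" "Cod C x = Cod C p" "Dom C x = Cod C q" "x \<cdot> q = p"
    and y: "y \<in> Arr C" "Cod C y = Cod C q" "Dom C y = Cod C p" "y \<cdot> p = q"
  shows "colifts_uniquely C q p" "is_iso C (colift C q p)"
  using chosen_homological.monics_lift_iso[OF dual, of p q x y] assms by simp_all

text \<open>Both composite epics are universal among arrows killing \<open>fs'\<close> and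
  \<open>bhat\<close> simultaneously, so each factors through the other.\<close>

lemma cokernels_of_induced_iso:
  assumes [simp]: "fs \<in> Arr C" "fs' \<in> Arr C" "a \<in> Arr C" "bhat \<in> Arr C" "h \<in> Arr C" "eta \<in> Arr C"
      "Dom C a = Dom C fs" "Dom C bhat = Cod C fs" "Cod C a = Dom C fs'"
      "Cod C bhat = Cod C fs'" "Dom C h = Cod C (coker fs)" "Cod C h = Cod C (coker fs')"
      "Dom C eta = Cod C (coker a)" "Cod C eta = Cod C (coker bhat)"
    and h: "h \<cdot> coker fs = coker fs' \<cdot> bhat" and eta: "eta \<cdot> coker a = coker bhat \<cdot> fs'"
  shows "colifts_uniquely C (coker h \<cdot> coker fs') (coker eta \<cdot> coker bhat)"
    "is_iso C (colift C (coker h \<cdot> coker fs') (coker eta \<cdot> coker bhat))"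
proof -
  note [simp] = h eta comp_assoc_subst[OF h] comp_assoc_subst[OF eta]
  have "coker eta \<cdot> eta \<cdot> coker a \<in> Null C" by (rule null_comp_mid) (simp_all del: eta)
  then have "(coker eta \<cdot> coker bhat) \<cdot> fs' \<in> Null C" by simp
  then obtain y where y: "y \<in> Arr C" "Dom C y = Cod C (coker fs')" "Cod C y = Cod C (coker eta)"
      "y \<cdot> coker fs' = coker eta \<cdot> coker bhat"
    using cokernel_factor[OF Coker_cokernel, of fs' "coker eta \<cdot> coker bhat"] by auto
  have "(y \<cdot> h) \<cdot> coker fs \<in> Null C" using y comp_assoc_subst[OF y(4), of bhat] by simp
  then have "y \<cdot> h \<in> Null C"
    by (rule Coker_reflects_null[of _ fs]) (use y in simp_all)
  then obtain x where x: "x \<in> Arr C" "Dom C x = Cod C (coker h)" "Cod C x = Cod C y"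
      "x \<cdot> coker h = y"
    using cokernel_factor[OF Coker_cokernel, of h y] y by auto
  have "coker h \<cdot> h \<cdot> coker fs \<in> Null C" by (rule null_comp_mid) (simp_all del: h)
  then have "(coker h \<cdot> coker fs') \<cdot> bhat \<in> Null C" by simp
  then obtain z where z: "z \<in> Arr C" "Dom C z = Cod C (coker bhat)" "Cod C z = Cod C (coker h)"
      "z \<cdot> coker bhat = coker h \<cdot> coker fs'"
    using cokernel_factor[OF Coker_cokernel, of bhat "coker h \<cdot> coker fs'"] by auto
  have "(z \<cdot> eta) \<cdot> coker a \<in> Null C" using z comp_assoc_subst[OF z(4), of fs'] by simp
  then have "z \<cdot> eta \<in> Null C"
    by (rule Coker_reflects_null[of _ a]) (use z in simp_all)
  then obtain w where w: "w \<in> Arr C" "Dom C w = Cod C (coker eta)" "Cod C w = Cod C z"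
      "w \<cdot> coker eta = z"
    using cokernel_factor[OF Coker_cokernel, of eta z] z by auto
  note L = epics_colift_iso[of "coker eta \<cdot> coker bhat" "coker h \<cdot> coker fs'" x w]
  have e: "epic C (coker eta \<cdot> coker bhat)" "epic C (coker h \<cdot> coker fs')"
    by (intro epic_comp; simp)+
  have c: "x \<cdot> coker h \<cdot> coker fs' = coker eta \<cdot> coker bhat"
    "w \<cdot> coker eta \<cdot> coker bhat = coker h \<cdot> coker fs'"
    using x y z w by (simp_all add: comp_assoc_subst[OF x(4)] comp_assoc_subst[OF w(4)])
  show "colifts_uniquely C (coker h \<cdot> coker fs') (coker eta \<cdot> coker bhat)"
    "is_iso C (colift C (coker h \<cdot> coker fs') (coker eta \<cdot> coker bhat))"
    using L e c x y z w by simp_all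
qed

end

section \<open>The kernel of the induced morphism, and vanishing of Lambda after beta\<close>

context lambek_diagram
begin

text \<open>These arrows stay outside the locale parameters: in the dual instance \<open>fs'\<close>
  and \<open>bhat\<close> already occur as \<open>gb\<close> and \<open>bch\<close>.\<close>

lemma induced_homology:
  assumes "fs = lift C (ker g) f" "fs' = lift C (ker g') f'" "bhat = lift C (ker g') (b \<cdot> ker g)"
  shows "lifts_uniquely C (ker g) f" "fs \<in> Arr C" "Dom C fs = Dom C f" "Cod C fs = Dom C (ker g)"
    "ker g \<cdot> fs = f"
    "lifts_uniquely C (ker g') f'" "fs' \<in> Arr C" "Dom C fs' = Dom C f'"
    "Cod C fs' = Dom C (ker g')" "ker g' \<cdot> fs' = f'"
    "lifts_uniquely C (ker g') (b \<cdot> ker g)" "bhat \<in> Arr C" "Dom C bhat = Dom C (ker g)"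
    "Cod C bhat = Dom C (ker g')" "ker g' \<cdot> bhat = b \<cdot> ker g"
    "fs' \<cdot> a = bhat \<cdot> fs"
    "colifts_uniquely C (coker fs) (coker fs' \<cdot> bhat)"
proof -
  have "(c \<cdot> g) \<cdot> ker g \<in> Null C" by (simp del: comm)
  then have n: "g' \<cdot> b \<cdot> ker g \<in> Null C" by simp
  show 1 [simp]: "lifts_uniquely C (ker g) f" "fs \<in> Arr C" "Dom C fs = Dom C f"
    "Cod C fs = Dom C (ker g)" "ker g \<cdot> fs = f"
    "lifts_uniquely C (ker g') f'" "fs' \<in> Arr C" "Dom C fs' = Dom C f'"
    "Cod C fs' = Dom C (ker g')" "ker g' \<cdot> fs' = f'"
    "lifts_uniquely C (ker g') (b \<cdot> ker g)" "bhat \<in> Arr C" "Dom C bhat = Dom C (ker g)"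
    "Cod C bhat = Dom C (ker g')" "ker g' \<cdot> bhat = b \<cdot> ker g"
    using kernel_lift[OF Ker_kernel, of g f] kernel_lift[OF Ker_kernel, of g' f']
      kernel_lift[OF Ker_kernel, of g' "b \<cdot> ker g"] n assms
    by simp_all
  show 2: "fs' \<cdot> a = bhat \<cdot> fs"
    by (rule monicD[OF Ker_monic[OF arrs(4)]])
      (simp_all add: comp_assoc_subst[OF 1(10)] comp_assoc_subst[OF 1(15)])
  have "coker fs' \<cdot> fs' \<cdot> a \<in> Null C" by (rule null_comp_mid) simp_all
  then have "(coker fs' \<cdot> bhat) \<cdot> fs \<in> Null C" by (simp add: 2)
  then show "colifts_uniquely C (coker fs) (coker fs' \<cdot> bhat)"
    using cokernel_colift[OF Coker_cokernel, of fs "coker fs' \<cdot> bhat"] by simp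
qed

lemma induced_homology_colift:
  assumes "fs = lift C (ker g) f" "fs' = lift C (ker g') f'" "bhat = lift C (ker g') (b \<cdot> ker g)"
    "h = colift C (coker fs) (coker fs' \<cdot> bhat)"
  shows "h \<in> Arr C" "Dom C h = Cod C (coker fs)" "Cod C h = Cod C (coker fs')"
    "h \<cdot> coker fs = coker fs' \<cdot> bhat"
proof -
  note [simp] = induced_homology[OF assms(1-3)]
  have "is_colift C (coker fs) (coker fs' \<cdot> bhat) h"
    unfolding assms(4) colift_def
    using induced_homology(17)[OF assms(1-3)] unfolding colifts_uniquely_def by (rule theI')
  then show "h \<in> Arr C" "Dom C h = Cod C (coker fs)" "Cod C h = Cod C (coker fs')"
    "h \<cdot> coker fs = coker fs' \<cdot> bhat"
    by (auto simp: is_colift_def hom_def)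
qed

text \<open>The morphism \<open>h\<close> lives between cokernels, whereas the kernel of
  \<open>eta\<close> lies over the cokernel of \<open>f\<close>; \<open>m\<close> carries the kernel
  of \<open>h\<close> there. The comparison for the cokernel of \<open>h\<close> takes place over
  the domain of \<open>ker g'\<close> and involves no such transfer, so the two statements are not
  dual to each other.\<close>

lemma kernels_of_induced_iso:
  assumes "fs = lift C (ker g) f" "fs' = lift C (ker g') f'" "bhat = lift C (ker g') (b \<cdot> ker g)"
    "h = colift C (coker fs) (coker fs' \<cdot> bhat)" "m = homology_iso C f g"
  shows "lifts_uniquely C (ker gb \<cdot> m \<cdot> ker h) (ker bch \<cdot> ker eta)"
    "is_iso C (lift C (ker gb \<cdot> m \<cdot> ker h) (ker bch \<cdot> ker eta))"
proof -
  note [simp] = induced_homology[OF assms(1-3)] induced_homology_colift[OF assms(1-4)]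
  note h_subst = comp_assoc_subst[OF induced_homology_colift(4)[OF assms(1-4)]]
  note bhat_subst = comp_assoc_subst[OF induced_homology(15)[OF assms(1-3)]]
  define gb' where "gb' = colift C (coker f') g'"
  define m' where "m' = homology_iso C f' g'"
  have [simp]: "gb' \<in> Arr C" "Dom C gb' = Cod C (coker f')"
    using cokernel_colift[OF Coker_cokernel, of f' g'] by (simp_all add: gb'_def)
  have m: "m \<in> Arr C" "Dom C m = Cod C (coker fs)" "Cod C m = Dom C (ker gb)"
     "ker gb \<cdot> m \<cdot> coker fs = coker f \<cdot> ker g" and mi: "is_iso C m"
    using homology_iso_typing[of f g] homology_iso(3)[of f g] assms(1,5) by (simp_all add: gb_def)
  have m': "m' \<in> Arr C" "Dom C m' = Cod C (coker fs')" "Cod C m' = Dom C (ker gb')"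
     "ker gb' \<cdot> m' \<cdot> coker fs' = coker f' \<cdot> ker g'" and mi': "is_iso C m'"
    using homology_iso_typing[of f' g'] homology_iso(3)[of f' g'] assms(2)
    by (simp_all add: gb'_def m'_def)
  note [simp] = m m' mi mi'
  have mono': "monic C (ker gb \<cdot> m \<cdot> ker h)"
    by (intro monic_comp Ker_monic iso_monic[OF mi]) simp_all
  have mono: "monic C (ker bch \<cdot> ker eta)"
    by (intro monic_comp) simp_all
  have m's: "ker gb' \<cdot> m' \<cdot> coker fs' \<cdot> bhat = coker f' \<cdot> b \<cdot> ker g"
    using comp_assoc[of bhat "m' \<cdot> coker fs'" "ker gb'"] by simp
  \<comment> \<open>This says that \<open>h\<close> is also induced by \<open>bch\<close> on the
    right realizations, with \<open>m\<close> and \<open>m'\<close> as identifications; it is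
    checked after the epic \<open>coker fs\<close>.\<close>
  have "(bch \<cdot> ker gb \<cdot> m) = (ker gb' \<cdot> m' \<cdot> h)"
    by (rule epicD[OF Coker_epic[OF induced_homology(2)[OF assms(1-3)]]]) (simp_all add: m's)
  then have E: "bch \<cdot> ker gb \<cdot> m \<cdot> x = ker gb' \<cdot> m' \<cdot> h \<cdot> x"
    if "x \<in> Arr C" "Cod C x = Cod C (coker fs)" for x
    using comp_assoc[of x "ker gb \<cdot> m" bch] comp_assoc[of x "m' \<cdot> h" "ker gb'"] that by simp
  \<comment> \<open>Both subobjects of \<open>Coker f\<close> are the meet of \<open>ker gb\<close> and \<open>ker bch\<close>.\<close>
  have "gb \<cdot> ker bch \<cdot> ker eta \<in> Null C"
  proof -
    have "ker c \<cdot> eta \<cdot> ker eta \<in> Null C" by (rule null_comp_left) simp_all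
    then show ?thesis by simp
  qed
  then obtain y where y: "y \<in> Arr C" "Dom C y = Dom C (ker eta)" "Cod C y = Dom C (ker gb)"
      "ker gb \<cdot> y = ker bch \<cdot> ker eta"
    using kernel_factor[OF Ker_kernel, of gb "ker bch \<cdot> ker eta"] by auto
  define z where "z = inverse_arr C m \<cdot> y"
  have [simp]: "z \<in> Arr C" "Dom C z = Dom C (ker eta)" "Cod C z = Cod C (coker fs)" "m \<cdot> z = y"
    using y by (simp_all add: z_def)
  have "bch \<cdot> ker bch \<cdot> ker eta \<in> Null C" by (rule null_comp_mid) simp_all
  then have "ker gb' \<cdot> m' \<cdot> h \<cdot> z \<in> Null C" using E[of z] y by simp
  then have "m' \<cdot> h \<cdot> z \<in> Null C" by (rule Ker_reflects_null) simp_all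
  then have "inverse_arr C m' \<cdot> m' \<cdot> h \<cdot> z \<in> Null C" by (rule null_comp_left) simp_all
  then have "h \<cdot> z \<in> Null C" by simp
  then obtain w where w: "w \<in> Arr C" "Dom C w = Dom C z" "Cod C w = Dom C (ker h)" "ker h \<cdot> w = z"
    using kernel_factor[OF Ker_kernel, of h z] by auto
  have "bch \<cdot> ker gb \<cdot> m \<cdot> ker h \<in> Null C" using E[of "ker h"] by simp
  then obtain u where u: "u \<in> Arr C" "Dom C u = Dom C (ker h)" "Cod C u = Dom C (ker bch)"
      "ker bch \<cdot> u = ker gb \<cdot> m \<cdot> ker h"
    using kernel_factor[OF Ker_kernel, of bch "ker gb \<cdot> m \<cdot> ker h"] by auto
  have "gb \<cdot> ker gb \<cdot> m \<cdot> ker h \<in> Null C" by (rule null_comp_mid) simp_all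
  then have "ker c \<cdot> eta \<cdot> u \<in> Null C" using u by simp
  then have "eta \<cdot> u \<in> Null C" by (rule Ker_reflects_null) (use u in simp_all)
  then obtain s where s: "s \<in> Arr C" "Dom C s = Dom C u" "Cod C s = Dom C (ker eta)" "ker eta \<cdot> s = u"
    using kernel_factor[OF Ker_kernel, of eta u] u by auto
  note L = monics_lift_iso[OF mono mono', of w s]
  show "lifts_uniquely C (ker gb \<cdot> m \<cdot> ker h) (ker bch \<cdot> ker eta)"
    "is_iso C (lift C (ker gb \<cdot> m \<cdot> ker h) (ker bch \<cdot> ker eta))"
    using L w s u y by simp_all
qed

text \<open>Up to the invertible \<open>n\<close>, the arrow \<open>ker gb\<close> preceded by
  \<open>coker phi\<close> is \<open>coker f \<cdot> ker g\<close>. As \<open>coker phi\<close>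
  reflects nullity, \<open>w\<close> kills \<open>ker gb\<close>, through which \<open>x\<close>
  factors.\<close>

lemma null_on_homology:
  assumes [simp]: "w \<in> Arr C" "Dom C w = Cod C (coker f)" "x \<in> Arr C" "Cod C x = Cod C (coker f)"
    and w: "w \<cdot> coker f \<cdot> ker g \<in> Null C" and x: "gb \<cdot> x \<in> Null C"
  shows "w \<cdot> x \<in> Null C"
proof -
  define phi where "phi = lift C (ker g) f"
  have [simp]: "phi \<in> Arr C" "Cod C phi = Dom C (ker g)" "ker g \<cdot> phi = f"
    using kernel_lift[OF Ker_kernel, of g f] by (simp_all add: phi_def)
  obtain n where n: "is_iso C n" "Dom C n = Cod C (coker phi)" "Cod C n = Dom C (ker gb)"
      "ker gb \<cdot> n \<cdot> coker phi = coker f \<cdot> ker g"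
    by (rule subquotient_iso[OF Ker_kernel Coker_cokernel _ _ _ _ _ _ Coker_cokernel Ker_kernel,
          of g f phi gb]) simp_all
  note [simp] = n iso_Arr[OF n(1)]
  have "(w \<cdot> ker gb \<cdot> n) \<cdot> coker phi \<in> Null C" using w by simp
  then have "w \<cdot> ker gb \<cdot> n \<in> Null C" by (rule Coker_reflects_null) simp_all
  then have "(w \<cdot> ker gb \<cdot> n) \<cdot> inverse_arr C n \<in> Null C" by (rule null_comp_right) simp_all
  then have wk: "w \<cdot> ker gb \<in> Null C" by simp
  obtain y where y: "y \<in> Arr C" "Dom C y = Dom C x" "Cod C y = Dom C (ker gb)" "ker gb \<cdot> y = x"
    using kernel_factor[OF Ker_kernel, of gb x] x by auto
  have "w \<cdot> ker gb \<cdot> y \<in> Null C" using wk by (rule null_comp_mid) (use y in simp_all)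
  with y show ?thesis by simp
qed

lemma lambek_beta_null: "lambek_h C S T \<cdot> beta0 \<in> Null C"
proof (rule kernel_reflects_null[OF Ker_kernel[OF sq_rho_typing(1)[OF comm_sqs(2)]]])
  have "coim C g \<cdot> f \<in> Null C" by (rule coim_comp_null) simp_all
  then have n: "(sq_in2 C T \<cdot> coim C g) \<cdot> f \<in> Null C" by simp
  then obtain w where w: "w \<in> Arr C" "Dom C w = Cod C (coker f)" "Cod C w = Cod C (sq_in1 C T)"
      "w \<cdot> coker f = sq_in2 C T \<cdot> coim C g"
    using cokernel_factor[OF Coker_cokernel, of f "sq_in2 C T \<cdot> coim C g"] by auto
  have E: "sq_in1 C T \<cdot> coim C b = sq_in2 C T \<cdot> coim C g"
    "sq_in1 C S1 \<cdot> coim C b = sq_in2 C S1 \<cdot> coim C (coker f)" by simp_all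
  \<comment> \<open>Since \<open>sq_in1 C S1\<close> is a cokernel of
    \<open>coim C b \<cdot> f\<close>, which \<open>sq_in1 C T\<close> kills, the latter factors
    through it; this factor is the link \<open>th\<close>.\<close>
  have "sq_in1 C T \<cdot> coim C b \<cdot> f \<in> Null C"
    using n comp_assoc_subst[OF E(1), of f] by simp
  then obtain th where th: "th \<in> Arr C" "Dom C th = Cod C (sq_in1 C S1)"
      "Cod C th = Cod C (sq_in1 C T)" "th \<cdot> sq_in1 C S1 = sq_in1 C T"
    using cokernel_factor[OF in1_S1_cokernel, of "sq_in1 C T"] by auto
  note [simp] = w th comp_assoc_subst[OF w(4)] comp_assoc_subst[OF th(4)]
  \<comment> \<open>On the other coprojection \<open>th\<close> acts as \<open>w\<close>, the exact
    \<open>coker f\<close> identifying its coimage with its codomain.\<close>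
  have "th \<cdot> sq_in2 C S1 = w \<cdot> im C (coker f) \<cdot> bar C (coker f)"
  proof (rule epicD[OF coim_typing(3)])
    have "(th \<cdot> sq_in2 C S1) \<cdot> coim C (coker f) = th \<cdot> sq_in1 C S1 \<cdot> coim C b"
      by (simp del: th(4) comp_assoc_subst[OF th(4)])
    also have "\<dots> = sq_in1 C T \<cdot> coim C b"
      using comp_assoc_subst[OF th(4), of "coim C b"] by simp
    finally show "(th \<cdot> sq_in2 C S1) \<cdot> coim C (coker f) =
        (w \<cdot> im C (coker f) \<cdot> bar C (coker f)) \<cdot> coim C (coker f)" by simp
  qed simp_all
  note th2 = comp_assoc_subst[OF this]
  \<comment> \<open>Before the epic \<open>coker (sq_lam C S)\<close> is cancelled, both sides are
    the connecting composite into the pushout of \<open>T\<close>. This turns one Lambek morphism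
    into the other and lets the inverse inside \<open>beta0\<close> cancel.\<close>
  have "th \<cdot> ker (sq_rho C S1) \<cdot> lambek_h C S S1 = ker (sq_rho C T) \<cdot> lambek_h C S T"
  proof (rule epicD[OF Coker_epic])
    have "th \<cdot> ker (sq_rho C S1) \<cdot> lambek_h C S S1 \<cdot> coker (sq_lam C S) =
      th \<cdot> sq_in1 C S1 \<cdot> inverse_arr C (bar C b) \<cdot> sq_pr1 C S"
      by (simp only: SS1_eq)
    also have "\<dots> = sq_in1 C T \<cdot> inverse_arr C (bar C b) \<cdot> sq_pr1 C S"
      using exact_Arr[OF b_exact] by simp
    finally show "(th \<cdot> ker (sq_rho C S1) \<cdot> lambek_h C S S1) \<cdot> coker (sq_lam C S) =
        (ker (sq_rho C T) \<cdot> lambek_h C S T) \<cdot> coker (sq_lam C S)"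
      using ST_eq by simp
  qed simp_all
  note thL = comp_assoc_subst[OF this[symmetric]]
  note [simp] = lambek_SS1(2) exact_Arr(2)[OF coker_f_exact(1)]
  have "ker (sq_rho C T) \<cdot> lambek_h C S T \<cdot> beta0 =
      th \<cdot> ker (sq_rho C S1) \<cdot> lambek_v C S2 S1 \<cdot> t \<cdot> coker xi \<cdot> ker eta"
    using thL[of beta0] by (simp add: beta0_def)
  also have "t \<cdot> coker xi \<cdot> ker eta = coker (sq_lam C S2) \<cdot> mu \<cdot> ker eta"
    using comp_assoc_subst[OF t_eq, of "ker eta"] by simp
  also have "ker (sq_rho C S1) \<cdot> lambek_v C S2 S1 \<cdot> coker (sq_lam C S2) \<cdot> mu \<cdot> ker eta =
      (ker (sq_rho C S1) \<cdot> lambek_v C S2 S1 \<cdot> coker (sq_lam C S2)) \<cdot> mu \<cdot> ker eta" by simp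
  also have "\<dots> = sq_in2 C S1 \<cdot> inverse_arr C (bar C (coker f)) \<cdot> sq_pr2 C S2 \<cdot> mu \<cdot> ker eta"
    unfolding S2S1_eq[symmetric] by simp
  also have "th \<cdot> \<dots> = w \<cdot> im C (coker f) \<cdot> sq_pr2 C S2 \<cdot> mu \<cdot> ker eta"
    using th2[of "inverse_arr C (bar C (coker f)) \<cdot> sq_pr2 C S2 \<cdot> mu \<cdot> ker eta"] by simp
  \<comment> \<open>The pullback square of \<open>S2\<close> exchanges the image of
    \<open>coker f\<close> for that of \<open>ker bch\<close>, and \<open>mu\<close> supplies the
    remaining factors of \<open>ker bch\<close>.\<close>
  also have "im C (coker f) \<cdot> sq_pr2 C S2 \<cdot> mu \<cdot> ker eta = ker bch \<cdot> ker eta"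
  proof -
    have "im C (coker f) \<cdot> sq_pr2 C S2 \<cdot> mu \<cdot> ker eta =
        im C (ker bch) \<cdot> sq_pr1 C S2 \<cdot> mu \<cdot> ker eta"
      using comp_assoc_subst[OF sq_pr_typing(6)[OF comm_sqs(4), unfolded sq_sel], of "mu \<cdot> ker eta"]
      by simp
    also have "\<dots> = ker bch \<cdot> ker eta" by (simp add: comp_assoc_subst[OF mu_eq])
    finally show ?thesis .
  qed
  also have "w \<cdot> ker bch \<cdot> ker eta \<in> Null C"
  proof (rule null_on_homology)
    have "coim C g \<cdot> ker g \<in> Null C" using cokernel_Arr[OF coim_typing(4)[of g]] by simp
    then show "w \<cdot> coker f \<cdot> ker g \<in> Null C" by simp
    have "ker c \<cdot> eta \<cdot> ker eta \<in> Null C" by (rule null_comp_left) simp_all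
    then show "gb \<cdot> ker bch \<cdot> ker eta \<in> Null C" by simp
  qed simp_all
  finally show "ker (sq_rho C T) \<cdot> lambek_h C S T \<cdot> beta0 \<in> Null C" .
qed simp_all

end

section \<open>The null sequence\<close>

theorem mainTheorem2:
  fixes C :: "('o, 'm) chosen_category" (structure)
  assumes "homological_category C" and "chosen_limits C"
    \<comment> \<open>the diagram\<close>
    and "f \<in> hom C A B" and "g \<in> hom C B D"
    and "f' \<in> hom C A' B'" and "g' \<in> hom C B' D'"
    and "a \<in> hom C A A'" and "b \<in> hom C B B'" and "c \<in> hom C D D'"
    and "b \<cdot> f = f' \<cdot> a" and "c \<cdot> g = g' \<cdot> b"
    and "g \<cdot> f \<in> Null C" and "g' \<cdot> f' \<in> Null C"
    and "exact_arr C b"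
    \<comment> \<open>the induced morphisms\<close>
    and "gb = colift C (coker f) g"
    and "fs = lift C (ker g) f"
    and "fs' = lift C (ker g') f'"
    and "bhat = lift C (ker g') (b \<cdot> ker g)"
    and "bcheck = colift C (coker f) (coker f' \<cdot> b)"
    and "h = colift C (coker fs) (coker fs' \<cdot> bhat)"
    and "m = homology_iso C f g"
    and "xi = lift C (ker bcheck) (coker f \<cdot> ker b)"
    and "eta = lift C (ker c) (gb \<cdot> ker bcheck)"
    and "eta' = colift C (coker a) (coker bhat \<cdot> fs')"
    and "xi' = colift C (coker bhat) (coker b \<cdot> ker g')"
    \<comment> \<open>the canonical isomorphisms from Ker eta to Ker h and from Coker h to Coker eta'\<close>
    and "i = lift C (ker gb \<cdot> m \<cdot> ker h) (ker bcheck \<cdot> ker eta)"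
    and "i' = colift C (coker h \<cdot> coker fs') (coker eta' \<cdot> coker bhat)"
    \<comment> \<open>alpha\<close>
    and "k = lift C (ker b) (f \<cdot> ker (b \<cdot> f))"
    and "k' = lift C (ker (eta \<cdot> xi)) k"
    and "v = lift C (ker eta) (xi \<cdot> ker (eta \<cdot> xi))"
    and "alpha = i \<cdot> colift C (coker k') v"
    \<comment> \<open>the squares\<close>
    and "S = Square f a b f'"
    and "T = Square g b c g'"
    and "S1 = Square (coker f) b bcheck (coker f')"
    and "S2 = Square xi (ker b) (ker bcheck) (coker f)"
    and "T1 = Square (ker g) bhat b (ker g')"
    and "T2 = Square (ker g') (coker bhat) (coker b) xi'"
    \<comment> \<open>the canonical isomorphism from Coker xi to Im S2, and beta\<close>
    and "mu = lift C (sq_pr1 C S2) (bar C (ker bcheck) \<cdot> coim C (ker bcheck))"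
    and "t = colift C (coker xi) (coker (sq_lam C S2) \<cdot> mu)"
    and "beta = inverse_arr C (lambek_h C S S1) \<cdot> lambek_v C S2 S1 \<cdot> t \<cdot>
                coker xi \<cdot> ker eta \<cdot> inverse_arr C i"
    \<comment> \<open>the canonical isomorphism from Ker T2 to Ker xi', and beta'\<close>
    and "nu = colift C (sq_in1 C T2) (im C (coker bhat) \<cdot> bar C (coker bhat))"
    and "t' = lift C (ker xi') (nu \<cdot> ker (sq_rho C T2))"
    and "beta' = inverse_arr C i' \<cdot> coker eta' \<cdot> ker xi' \<cdot> t' \<cdot>
                 lambek_v C T1 T2 \<cdot> inverse_arr C (lambek_h C T1 T)"
    \<comment> \<open>alpha'\<close>
    and "l = colift C (coker b) (coker (g' \<cdot> b) \<cdot> g')"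
    and "l' = colift C (coker (xi' \<cdot> eta')) l"
    and "u = colift C (coker eta') (coker (xi' \<cdot> eta') \<cdot> xi')"
    and "alpha' = lift C (ker l') u \<cdot> i'"
    \<comment> \<open>Lambda\<close>
    and "L = lambek_h C S T"
  shows
    \<comment> \<open>all ingredients are well defined\<close>
    "(\<forall>x \<in> Arr C. \<exists>!y. is_bar C x y) \<and>
     colifts_uniquely C (coker f) g \<and>
     lifts_uniquely C (ker g) f \<and>
     lifts_uniquely C (ker g') f' \<and>
     lifts_uniquely C (ker g') (b \<cdot> ker g) \<and>
     colifts_uniquely C (coker f) (coker f' \<cdot> b) \<and>
     colifts_uniquely C (coker fs) (coker fs' \<cdot> bhat) \<and>
     (\<exists>!x. is_homology_iso C f g x) \<and> is_iso C m \<and>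
     lifts_uniquely C (ker bcheck) (coker f \<cdot> ker b) \<and>
     lifts_uniquely C (ker c) (gb \<cdot> ker bcheck) \<and>
     colifts_uniquely C (coker a) (coker bhat \<cdot> fs') \<and>
     colifts_uniquely C (coker bhat) (coker b \<cdot> ker g') \<and>
     lifts_uniquely C (ker gb \<cdot> m \<cdot> ker h) (ker bcheck \<cdot> ker eta) \<and> is_iso C i \<and>
     colifts_uniquely C (coker h \<cdot> coker fs') (coker eta' \<cdot> coker bhat) \<and> is_iso C i' \<and>
     lifts_uniquely C (ker b) (f \<cdot> ker (b \<cdot> f)) \<and>
     (eta \<cdot> xi) \<cdot> k \<in> Null C \<and>
     lifts_uniquely C (ker (eta \<cdot> xi)) k \<and>
     lifts_uniquely C (ker eta) (xi \<cdot> ker (eta \<cdot> xi)) \<and>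
     colifts_uniquely C (coker k') v \<and>
     sq_Im_defined C S \<and> sq_Im_defined C S2 \<and> sq_Im_defined C T1 \<and>
     sq_Ker_defined C T \<and> sq_Ker_defined C S1 \<and> sq_Ker_defined C T2 \<and>
     (\<exists>!x. is_lambek_h C S T x) \<and>
     (\<exists>!x. is_lambek_h C S S1 x) \<and> is_iso C (lambek_h C S S1) \<and>
     (\<exists>!x. is_lambek_v C S2 S1 x) \<and> is_iso C (lambek_v C S2 S1) \<and>
     (\<exists>!x. is_lambek_h C T1 T x) \<and> is_iso C (lambek_h C T1 T) \<and>
     (\<exists>!x. is_lambek_v C T1 T2 x) \<and> is_iso C (lambek_v C T1 T2) \<and>
     lifts_uniquely C (sq_pr1 C S2) (bar C (ker bcheck) \<cdot> coim C (ker bcheck)) \<and>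
     colifts_uniquely C (coker xi) (coker (sq_lam C S2) \<cdot> mu) \<and> is_iso C t \<and>
     colifts_uniquely C (sq_in1 C T2) (im C (coker bhat) \<cdot> bar C (coker bhat)) \<and>
     lifts_uniquely C (ker xi') (nu \<cdot> ker (sq_rho C T2)) \<and> is_iso C t' \<and>
     colifts_uniquely C (coker b) (coker (g' \<cdot> b) \<cdot> g') \<and>
     l \<cdot> (xi' \<cdot> eta') \<in> Null C \<and>
     colifts_uniquely C (coker (xi' \<cdot> eta')) l \<and>
     colifts_uniquely C (coker eta') (coker (xi' \<cdot> eta') \<cdot> xi') \<and>
     lifts_uniquely C (ker l') u \<and>
     \<comment> \<open>the sequence\<close>
     alpha \<in> hom C (Cod C (coker k')) (Dom C (ker h)) \<and>
     beta \<in> hom C (Dom C (ker h)) (sq_Im C S) \<and>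
     L \<in> hom C (sq_Im C S) (sq_Ker C T) \<and>
     beta' \<in> hom C (sq_Ker C T) (Cod C (coker h)) \<and>
     alpha' \<in> hom C (Cod C (coker h)) (Dom C (ker l')) \<and>
     \<comment> \<open>which is null\<close>
     beta \<cdot> alpha \<in> Null C \<and>
     L \<cdot> beta \<in> Null C \<and>
     beta' \<cdot> L \<in> Null C \<and>
     alpha' \<cdot> beta' \<in> Null C"
proof -
  note defs = assms(15-)
  note typing [simp] = assms(3-9)[unfolded hom_def, simplified]
  interpret chosen_homological C using assms(1,2) by (simp add: chosen_homological_def)
  interpret P: lambek_diagram C f g f' g' a b c gb bcheck xi eta k k' v mu t S T S1 S2
    by (intro lambek_diagram.intro lambek_diagram_axioms.intro chosen_homological_axioms)
      (rule defs | simp add: assms(10-14))+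
  note H = P.induced_homology[OF defs(2-4)]
  note [simp] = H(2-5,7-10,12-16) P.induced_homology_colift[OF defs(2-4,6)]
  \<comment> \<open>The arrow \<open>xi'\<close> must be typed before the dual interpretation:
    translating the invariants of \<open>T2\<close> requires a commutative square.\<close>
  have "coker b \<cdot> b \<cdot> ker g \<in> Null C" by (rule null_comp_mid) simp_all
  then have "(coker b \<cdot> ker g') \<cdot> bhat \<in> Null C" by simp
  note xi' = cokernel_colift[OF Coker_cokernel _ _ this, folded defs(11), simplified]
  have T12 [simp]: "comm_sq C T1" "comm_sq C T2"
    using xi' by (simp_all add: comm_sq_def defs(22,23))
  have flips: "flip S = Square f' b a f" "flip T = Square g' c b g"
    "flip T1 = Square (ker g') b bhat (ker g)"
    "flip T2 = Square xi' (coker b) (coker bhat) (ker g')"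
    by (simp_all add: defs)
  have sel [simp]: "s_top T1 = ker g" "s_left T1 = bhat" "s_right T1 = b" "s_bottom T1 = ker g'"
    "s_top T2 = ker g'" "s_left T2 = coker bhat" "s_right T2 = coker b" "s_bottom T2 = xi'"
    by (simp_all add: defs(22,23))
  have ker_g'_exact [simp]: "exact_arr C (ker g')"
    using kernel_exact[OF Ker_kernel, of g'] by simp
  note [simp] = opp_sq_lam opp_sq_rho opp_lambek_h opp_lambek_v opp_sq_Im_defined
  \<comment> \<open>Reversing arrows exchanges the two rows as well as their ends, so
    \<open>g'\<close> takes the place of \<open>f\<close> and \<open>c\<close> that of
    \<open>a\<close>, while \<open>b\<close> stays fixed.\<close>
  interpret D: lambek_diagram "opp C" g' f' g f c b a fs' bhat xi' eta' l l' u nu t'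
    "flip T" "flip S" "flip T1" "flip T2"
    by (intro lambek_diagram.intro lambek_diagram_axioms.intro dual)
      (rule flips | (simp; fail) | (simp, rule defs) | (simp add: flips; fail))+
  note Dl = D.eta[simplified] D.xi[simplified] D.k[simplified] D.eta_xi_k_null[simplified]
    D.k'[simplified] D.v[simplified] D.alpha[simplified] D.mu[simplified] D.t[simplified]
    D.t_iso[simplified] D.lambek_SS1(1,2)[simplified] D.lambek_S2S1(1,2)[simplified]
  note Ki = P.kernels_of_induced_iso[OF defs(2-4,6,7), folded defs(12)]
  have Ki_typing [simp]: "i \<in> Arr C" "Dom C i = Dom C (ker eta)" "Cod C i = Dom C (ker h)"
    using lifts_uniquelyD[OF Ki(1), folded defs(12)] homology_iso_typing[of f g, folded defs]
    by simp_all
  have Ki' : "colifts_uniquely C (coker h \<cdot> coker fs') (coker eta' \<cdot> coker bhat)" "is_iso C i'"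
    using cokernels_of_induced_iso[of fs fs' a bhat h eta'] D.eta_typing D.eta_eq H(16)
    by (simp_all add: defs(13)[symmetric])
  have Ki'_typing [simp]: "i' \<in> Arr C" "Dom C i' = Cod C (coker h)" "Cod C i' = Cod C (coker eta')"
    using colifts_uniquelyD[OF Ki'(1), folded defs(13)] D.eta_typing by simp_all
  note [simp] = Ki(2) Ki'(2) P.lambek_SS1(2)
  note [simp] = D.xi_typing[simplified] D.eta_typing[simplified] D.k'_typing[simplified]
    D.v_typing[simplified] D.alpha_typing[simplified] D.t_typing[simplified]
    D.SS1_typing[simplified] D.S2S1_typing[simplified] D.beta0_typing[simplified]
    D.lambek_SS1(2)[simplified]
  \<comment> \<open>Once \<open>i\<close> and \<open>i'\<close> are split off, they cancel or stand
    at the ends of the composites, where they preserve nullity; the claims become those for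
    \<open>beta0\<close> in the two instances.\<close>
  have beta: "beta = P.beta0 \<cdot> inverse_arr C i"
    by (simp add: defs(26) P.beta0_def)
  have beta': "beta' = inverse_arr C i' \<cdot> D.beta0"
    by (simp add: defs(29) D.beta0_def)
  have arrows: "alpha \<in> hom C (Cod C (coker k')) (Dom C (ker h))"
    "beta \<in> hom C (Dom C (ker h)) (sq_Im C S)" "L \<in> hom C (sq_Im C S) (sq_Ker C T)"
    "beta' \<in> hom C (sq_Ker C T) (Cod C (coker h))"
    "alpha' \<in> hom C (Cod C (coker h)) (Dom C (ker l'))"
    by (simp_all add: hom_def defs(17,33,34) beta beta' sq_Im_def sq_Ker_def)
  have n1: "beta \<cdot> alpha \<in> Null C"
    using P.beta0_alpha_null by (simp add: defs(17) beta)
  have n2: "L \<cdot> beta \<in> Null C"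
    using null_comp_right[OF P.lambek_beta_null, of "inverse_arr C i"] by (simp add: defs(34) beta)
  \<comment> \<open>The Lambek morphism of the flipped squares is again \<open>L\<close>, so this is
    the dual of the vanishing of Lambda after beta.\<close>
  have n3: "beta' \<cdot> L \<in> Null C"
    using null_comp_left[OF D.lambek_beta_null[simplified], of "inverse_arr C i'"]
    by (simp add: defs(34) beta')
  have n4: "alpha' \<cdot> beta' \<in> Null C"
    using D.beta0_alpha_null by (simp add: defs(33) beta')
  note hom_fg = homology_iso[of f g, folded defs(7)]
  show ?thesis
    by (intro conjI ballI is_bar_ex1 P.gb H(1,6,11,17) P.bch P.xi P.eta Ki Ki' P.k P.eta_xi_k_null
        P.k' P.v P.alpha sq_Im_definedI sq_Ker_definedI P.comm_sqs T12 P.lambek_ST(1)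
        P.lambek_SS1(1,2) P.lambek_S2S1(1,2) P.mu P.t P.t_iso Dl arrows n1 n2 n3 n4)
      (use hom_fg in simp_all)
qed

end
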